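(* Let $K$ be a field, $P=K[x_1,\dots,x_n]$, let $\mathcal{O}=\{t_1,\dots,t_\mu\}$ be a (nonempty) order ideal of monomials in $P$ and $\sigma$ a term ordering on $\mathbb{T}^n$. Then $I(\mathbb{G}_{\mathcal{O},\sigma})$ is an $(\mathcal{O},\sigma)$-reduction ideal of $K[S_{c\mathcal{O},\sigma}]$.
   Context: Notation: $\mathbf{x}=x_1,\dots,x_n$, $\mathbb{T}^n=\{x_1^{\alpha_1}\cdots x_n^{\alpha_n}\mid\alpha_i\ge0\}$. An order ideal is a finite set $\mathcal{O}=\{t_1,\dots,t_\mu\}\subset\mathbb{T}^n$ (here nonempty) closed under taking divisors. Its border is $\partial\mathcal{O}=(x_1\mathcal{O}\cup\dots\cup x_n\mathcal{O})\setminus\mathcal{O}=\{b_1,\dots,b_\nu\}$. The corners $c\mathcal{O}\subseteq\partial\mathcal{O}$ are the minimal generators of the monoid ideal $\mathbb{T}^n\setminus\mathcal{O}$; the labelling is chosen so that $c\mathcal{O}=\{b_1,\dots,b_\eta\}$, $\eta\le\nu$. For an ideal $I\subseteq P$, $\mathcal{O}_\sigma(I)$ is the set of terms in $\mathbb{T}^n$ that are not $\sigma$-leading terms of nonzero elements of $I$. Let $\mathbf{c}=\{c_{ij}\mid 1\le i\le\mu,1\le j\le\nu\}$ be new indeterminates. For $k=1,\dots,n$ the generic multiplication matrix $\mathcal{A}_k\in\mathrm{Mat}_\mu(K[\mathbf{c}])$ has $(i,j)$ entry $\delta_{im}$ if $x_kt_j=t_m\in\mathcal{O}$, and $c_{im}$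 if $x_kt_j=b_m\in\partial\mathcal{O}$. $I(\mathbb{B}_{\mathcal{O}})\subseteq K[\mathbf{c}]$ is the ideal generated by all entries of all $\mathcal{A}_k\mathcal{A}_\ell-\mathcal{A}_\ell\mathcal{A}_k$, $1\le k<\ell\le n$. $S_{\mathcal{O},\sigma}=\{c_{ij}\mid b_j>_\sigma t_i\}$; $L_{\mathcal{O},\sigma}$ is the ideal of $K[\mathbf{c}]$ generated by the $c_{ij}\notin S_{\mathcal{O},\sigma}$; $S_{c\mathcal{O},\sigma}=\{c_{ij}\in S_{\mathcal{O},\sigma}\mid j\le\eta\}$. For $j=1,\dots,\eta$ let $g_j^*=b_j-\sum_{\{i\mid b_j>_\sigma t_i\}}c_{ij}t_i$. $I(\mathbb{G}_{\mathcal{O},\sigma})=(L_{\mathcal{O},\sigma}+I(\mathbb{B}_{\mathcal{O}}))\cap K[S_{c\mathcal{O},\sigma}]$. Definitions. An ideal $J\subseteq K[S_{c\mathcal{O},\sigma}]$ is an $(\mathcal{O},\sigma)$-parametrizing ideal if $\mathrm{Spec}(K[S_{c\mathcal{O},\sigma}]/J)$ parametrizes all zero-dimensional ideals $I\subset P$ with $\mathcal{O}=\mathcal{O}_\sigma(I)$, i.e. sending a $K$-rational zero $\mathbf{a}=(a_{ij})$ of $J$ to the ideal of $P$ generated by the polynomials $g_1^*,\dots,g_\eta^*$ specialized at $c_{ij}\mapsto a_{ij}$ is a bijection onto the set of such ideals. A parametrizing ideal $J$ is an $(\mathcal{O},\sigma)$-reduction ideal if there is a finite set $\mathcal{S}$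 of polynomials, each of the form $\sum_{j=1}^\eta f_jg_j^*=\sum_{t_i\in\mathcal{O}}r_it_i$ with $f_j\in K[\mathbf{x},S_{c\mathcal{O},\sigma}]$ and $r_i\in K[S_{c\mathcal{O},\sigma}]$, such that $J$ is generated by the coefficients $r_i$ of all elements of $\mathcal{S}$. *)

theory Defs
  imports Complex_Main "HOL-Algebra.Ideal" "HOL-Library.Poly_Mapping" "HOL-Library.FuncSet"
begin

section \<open>Terms and polynomials\<close>

text \<open>
  A term (power product) is its exponent vector, so the product of terms is \<open>+\<close> and the
  term \<open>1\<close> is \<open>0\<close>. The order that \<^theory>\<open>HOL-Library.Poly_Mapping\<close> puts on exponent
  vectors is lexicographic and is not used; divisibility of terms is \<open>tdvd\<close>.
  The coefficient ring of \<open>mpoly\<close> may itself be a polynomial ring.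
\<close>

type_synonym 'v monom = "'v \<Rightarrow>\<^sub>0 nat"
type_synonym ('v, 'r) mpoly = "'v monom \<Rightarrow>\<^sub>0 'r"

definition tdvd :: "'v monom \<Rightarrow> 'v monom \<Rightarrow> bool" where
  "tdvd s t \<longleftrightarrow> (\<exists>u. t = s + u)"

definition indet :: "'v \<Rightarrow> 'v monom" where
  "indet v = Poly_Mapping.single v 1"

definition const :: "'r::zero \<Rightarrow> ('v, 'r) mpoly" where
  "const r = Poly_Mapping.single 0 r"

definition polys_in :: "'v set \<Rightarrow> ('v, 'r::zero) mpoly set" where
  "polys_in V = {p. \<forall>m\<in>Poly_Mapping.keys p. Poly_Mapping.keys m \<subseteq> V}"

definition poly_ring :: "'v set \<Rightarrow> ('v, 'r::comm_ring_1) mpoly ring" where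
  "poly_ring V = \<lparr>carrier = polys_in V, mult = (*), one = 1, zero = 0, add = (+)\<rparr>"

definition eval_mpoly :: "('v \<Rightarrow> 'r) \<Rightarrow> ('v, 'r::comm_ring_1) mpoly \<Rightarrow> 'r" where
  "eval_mpoly a p =
     (\<Sum>m\<in>Poly_Mapping.keys p. Poly_Mapping.lookup p m *
        (\<Prod>v\<in>Poly_Mapping.keys m. a v ^ Poly_Mapping.lookup m v))"

definition term_ordering :: "'v monom rel \<Rightarrow> bool" where
  "term_ordering \<sigma> \<longleftrightarrow> linear_order \<sigma> \<and> (\<forall>t. (0, t) \<in> \<sigma>) \<and>
     (\<forall>s t u. (s, t) \<in> \<sigma> \<longrightarrow> (s + u, t + u) \<in> \<sigma>)"

definition term_less :: "'v monom rel \<Rightarrow> 'v monom \<Rightarrow> 'v monom \<Rightarrow> bool" where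
  "term_less \<sigma> s t \<longleftrightarrow> (s, t) \<in> \<sigma> \<and> s \<noteq> t"

definition leading_term :: "'v monom rel \<Rightarrow> ('v, 'r::zero) mpoly \<Rightarrow> 'v monom" where
  "leading_term \<sigma> f = (THE t. t \<in> Poly_Mapping.keys f \<and> (\<forall>s\<in>Poly_Mapping.keys f. (s, t) \<in> \<sigma>))"

definition nonleading_terms :: "'v monom rel \<Rightarrow> ('v, 'r::zero) mpoly set \<Rightarrow> 'v monom set" where
  "nonleading_terms \<sigma> I = {t. \<not> (\<exists>f\<in>I. f \<noteq> 0 \<and> leading_term \<sigma> f = t)}"

text \<open>\<open>P/I\<close> is a finite-dimensional vector space: \<open>P = I + span B\<close> for a finite \<open>B\<close>.\<close>

definition zero_dimensional :: "('n::finite, 'k::field) mpoly set \<Rightarrow> bool" where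
  "zero_dimensional I \<longleftrightarrow>
     (\<exists>B. finite B \<and> (\<forall>p. \<exists>q\<in>module.span (\<lambda>c f. const c * f) B. p - q \<in> I))"


section \<open>Order ideals, border and corners\<close>

definition order_ideal :: "'n monom set \<Rightarrow> bool" where
  "order_ideal \<O> \<longleftrightarrow> finite \<O> \<and> (\<forall>t\<in>\<O>. \<forall>s. tdvd s t \<longrightarrow> s \<in> \<O>)"

definition border :: "'n monom set \<Rightarrow> 'n monom set" where
  "border \<O> = (\<Union>k. (\<lambda>t. indet k + t) ` \<O>) - \<O>"

text \<open>The minimal generators of a monoid ideal are its elements minimal for divisibility.\<close>

definition corners :: "'n monom set \<Rightarrow> 'n monom set" where
  "corners \<O> = {b. b \<notin> \<O> \<and> (\<forall>s. s \<notin> \<O> \<and> tdvd s b \<longrightarrow> s = b)}"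


section \<open>The border basis scheme\<close>

text \<open>
  The indeterminate \<open>c\<^sub>i\<^sub>j\<close> is named by the pair \<open>(t\<^sub>i, b\<^sub>j)\<close> instead of the pair of positions
  \<open>(i, j)\<close>, so that no enumeration of \<open>\<O>\<close> and of its border has to be chosen; matrices in
  \<open>Mat\<^sub>\<mu>\<close> are accordingly indexed by \<open>\<O> \<times> \<O>\<close>. The type \<open>'n cvar\<close> also contains pairs
  that are not indeterminates; \<open>K[\<^bold>c]\<close> is \<open>poly_ring (cvars \<O>)\<close>.
\<close>

type_synonym 'n cvar = "'n monom \<times> 'n monom"

definition cvars :: "'n monom set \<Rightarrow> 'n cvar set" where
  "cvars \<O> = \<O> \<times> border \<O>"

definition cpoly :: "'n monom \<Rightarrow> 'n monom \<Rightarrow> ('n cvar, 'k::field) mpoly" where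
  "cpoly t b = Poly_Mapping.single (indet (t, b)) 1"

definition gen_mult_matrix ::
    "'n monom set \<Rightarrow> 'n \<Rightarrow> 'n monom \<Rightarrow> 'n monom \<Rightarrow> ('n cvar, 'k::field) mpoly" where
  "gen_mult_matrix \<O> k t s =
     (if indet k + s \<in> \<O> then (if t = indet k + s then 1 else 0)
      else cpoly t (indet k + s))"

text \<open>
  Entry \<open>(t, s)\<close> of \<open>\<A>\<^sub>k \<A>\<^sub>l - \<A>\<^sub>l \<A>\<^sub>k\<close>. All pairs \<open>(k, l)\<close> are used below, as \<open>'n\<close> carries no
  order: compared with \<open>k < l\<close> this adds only zeros and negatives of generators.
\<close>

definition commutator_entry ::
    "'n monom set \<Rightarrow> 'n \<Rightarrow> 'n \<Rightarrow> 'n monom \<Rightarrow> 'n monom \<Rightarrow> ('n cvar, 'k::field) mpoly" where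
  "commutator_entry \<O> k l t s =
     (\<Sum>u\<in>\<O>. gen_mult_matrix \<O> k t u * gen_mult_matrix \<O> l u s) -
     (\<Sum>u\<in>\<O>. gen_mult_matrix \<O> l t u * gen_mult_matrix \<O> k u s)"

definition border_scheme_ideal :: "'n monom set \<Rightarrow> ('n cvar, 'k::field) mpoly set" where
  "border_scheme_ideal \<O> =
     Idl\<^bsub>poly_ring (cvars \<O>)\<^esub> {commutator_entry \<O> k l t s | k l t s. t \<in> \<O> \<and> s \<in> \<O>}"


section \<open>The Groebner basis scheme\<close>

definition S_vars :: "'n monom set \<Rightarrow> 'n monom rel \<Rightarrow> 'n cvar set" where
  "S_vars \<O> \<sigma> = {(t, b) \<in> cvars \<O>. term_less \<sigma> t b}"

definition S_corner_vars :: "'n monom set \<Rightarrow> 'n monom rel \<Rightarrow> 'n cvar set" where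
  "S_corner_vars \<O> \<sigma> = {(t, b) \<in> S_vars \<O> \<sigma>. b \<in> corners \<O>}"

definition L_ideal :: "'n monom set \<Rightarrow> 'n monom rel \<Rightarrow> ('n cvar, 'k::field) mpoly set" where
  "L_ideal \<O> \<sigma> =
     Idl\<^bsub>poly_ring (cvars \<O>)\<^esub> {cpoly t b | t b. (t, b) \<in> cvars \<O> - S_vars \<O> \<sigma>}"

definition groebner_scheme_ideal ::
    "'n monom set \<Rightarrow> 'n monom rel \<Rightarrow> ('n cvar, 'k::field) mpoly set" where
  "groebner_scheme_ideal \<O> \<sigma> =
     (L_ideal \<O> \<sigma> <+>\<^bsub>poly_ring (cvars \<O>)\<^esub> border_scheme_ideal \<O>)
       \<inter> polys_in (S_corner_vars \<O> \<sigma>)"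

text \<open>
  Polynomials in \<open>\<^bold>x\<close> and \<open>\<^bold>c\<close> are polynomials in \<open>\<^bold>x\<close> with coefficients in \<open>K[\<^bold>c]\<close>. For a
  corner \<open>b = b\<^sub>j\<close>, \<open>gstar \<O> \<sigma> b\<close> is \<open>g\<^sub>j\<^sup>*\<close>.
\<close>

definition gstar ::
    "'n monom set \<Rightarrow> 'n monom rel \<Rightarrow> 'n monom \<Rightarrow> ('n, ('n cvar, 'k::field) mpoly) mpoly" where
  "gstar \<O> \<sigma> b = Poly_Mapping.single b 1 -
     (\<Sum>t\<in>{t\<in>\<O>. term_less \<sigma> t b}. Poly_Mapping.single t (cpoly t b))"

definition specialize ::
    "('n cvar \<Rightarrow> 'k) \<Rightarrow> ('n, ('n cvar, 'k::field) mpoly) mpoly \<Rightarrow> ('n, 'k) mpoly" where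
  "specialize a f = Poly_Mapping.map (eval_mpoly a) f"


section \<open>Parametrizing ideals and reduction ideals\<close>

definition rational_zeros :: "'v set \<Rightarrow> ('v, 'k::field) mpoly set \<Rightarrow> ('v \<Rightarrow> 'k) set" where
  "rational_zeros V J = {a \<in> V \<rightarrow>\<^sub>E UNIV. \<forall>f\<in>J. eval_mpoly a f = 0}"

definition parametrizing_ideal ::
    "'n::finite monom set \<Rightarrow> 'n monom rel \<Rightarrow> ('n cvar, 'k::field) mpoly set \<Rightarrow> bool" where
  "parametrizing_ideal \<O> \<sigma> J \<longleftrightarrow>
     ideal J (poly_ring (S_corner_vars \<O> \<sigma>)) \<and>
     bij_betw (\<lambda>a. Idl\<^bsub>poly_ring UNIV\<^esub> ((\<lambda>b. specialize a (gstar \<O> \<sigma> b)) ` corners \<O>))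
       (rational_zeros (S_corner_vars \<O> \<sigma>) J)
       {I. ideal I (poly_ring UNIV) \<and> zero_dimensional I \<and> nonleading_terms \<sigma> I = \<O>}"

definition coeffs_in :: "'r set \<Rightarrow> ('n, 'r::zero) mpoly set" where
  "coeffs_in R = {f. \<forall>m. Poly_Mapping.lookup f m \<in> R}"

text \<open>
  The \<open>r\<^sub>i\<close> with \<open>h = \<Sum> r\<^sub>i t\<^sub>i\<close> are unique, since they are the coefficients of \<open>h\<close>; the functions
  \<open>r h\<close> below list them.
\<close>

definition reduction_ideal ::
    "'n::finite monom set \<Rightarrow> 'n monom rel \<Rightarrow> ('n cvar, 'k::field) mpoly set \<Rightarrow> bool" where
  "reduction_ideal \<O> \<sigma> J \<longleftrightarrow> parametrizing_ideal \<O> \<sigma> J \<and>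
     (\<exists>(\<S> :: ('n, ('n cvar, 'k) mpoly) mpoly set) r. finite \<S> \<and>
        (\<forall>h\<in>\<S>.
           (\<exists>f. (\<forall>b\<in>corners \<O>. f b \<in> coeffs_in (polys_in (S_corner_vars \<O> \<sigma>))) \<and>
                h = (\<Sum>b\<in>corners \<O>. f b * gstar \<O> \<sigma> b)) \<and>
           (\<forall>t\<in>\<O>. r h t \<in> polys_in (S_corner_vars \<O> \<sigma>)) \<and>
           h = (\<Sum>t\<in>\<O>. Poly_Mapping.single t (r h t))) \<and>
        J = Idl\<^bsub>poly_ring (S_corner_vars \<O> \<sigma>)\<^esub> {r h t | h t. h \<in> \<S> \<and> t \<in> \<O>})"

end

theory Submission
  imports Defs
begin

text \<open>
  Write \<open>R\<close> for the polynomial ring in the indeterminates of \<open>S_corner_vars \<O> \<sigma>\<close>, and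
  \<open>J = (L + I(B)) \<inter> R\<close> for the ideal of the Groebner basis scheme, \<open>L\<close> being \<open>L_ideal \<O> \<sigma>\<close> and
  \<open>I(B)\<close> the ideal of the border basis scheme. Let \<open>G\<close> be the ideal of \<open>R[x]\<close> generated by the
  \<open>g\<^sub>b\<^sup>*\<close> for the corners \<open>b\<close>.

  Since each \<open>g\<^sub>b\<^sup>*\<close> is monic with leading term \<open>b\<close>, division works over \<open>R\<close>: every term \<open>m\<close> is
  congruent modulo \<open>G\<close> to a combination \<open>reduct m\<close> of terms of \<open>\<O>\<close> that are at most \<open>m\<close>
  (\<open>normal_form_term\<close>; the recursion ends because \<open>\<sigma>\<close> is well-founded, by Dickson's lemma). Reducing
  the product of \<open>x\<^sub>k\<close>, \<open>x\<^sub>l\<close> and \<open>s \<in> \<O>\<close> in two orders gives two combinations of \<open>\<O>\<close> whose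
  difference \<open>syzygy k l s\<close> lies in \<open>G\<close>. These finitely many elements are the reduction polynomials: the
  claim is that their coefficients generate \<open>J\<close> (\<open>groebner_scheme_ideal_eq\<close>).

  To see that \<open>J\<close> is contained in the ideal of the coefficients, send every \<open>c\<^sub>t\<^sub>b\<close> to the
  coefficient of \<open>t\<close> in \<open>reduct b\<close>. This ring homomorphism fixes \<open>R\<close>, kills \<open>L\<close>, and maps the generic
  multiplication matrices to the matrices of the reductions, hence the entries of the commutators to the
  coefficients of the \<open>syzygy k l s\<close>.

  The converse holds for every \<open>f \<in> G\<close> supported on \<open>\<O>\<close> (\<open>gstar_module_coeff\<close>). Modulo \<open>L + I(B)\<close>
  the generic multiplication matrices commute, so polynomials in \<open>x\<close> act on vectors indexed by \<open>\<O>\<close>. Applied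
  to the unit vector of the term \<open>1\<close>, a term \<open>t \<in> \<O>\<close> gives the unit vector of \<open>t\<close>, while
  every \<open>g\<^sub>b\<^sup>*\<close> gives \<open>0\<close>. So \<open>f\<close> gives its own vector of coefficients on the one hand and \<open>0\<close> on
  the other, which means that these coefficients lie in \<open>L + I(B)\<close>.

  That \<open>J\<close> is parametrizing follows with the same tools. At a zero \<open>a\<close> of \<open>J\<close> the specialised reduction
  matrices commute over \<open>K\<close>, and the same action, now triangular with respect to \<open>\<sigma>\<close>, shows that no
  element of the ideal of \<open>a\<close> has its leading term in \<open>\<O>\<close> (\<open>fibre_leading_term\<close>). Conversely, an
  ideal \<open>I\<close> whose nonleading terms are \<open>\<O>\<close> determines the normal forms of the corners, hence a point
  \<open>a\<close>; the specialised \<open>syzygy k l s\<close> are elements of \<open>I\<close> supported on \<open>\<O>\<close>, so they vanish, and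
  \<open>a\<close> is a zero of \<open>J\<close> (\<open>fibre_surj\<close>).
\<close>

abbreviation keys :: "('a \<Rightarrow>\<^sub>0 'b::zero) \<Rightarrow> 'a set" where "keys \<equiv> Poly_Mapping.keys"
abbreviation lookup :: "('a \<Rightarrow>\<^sub>0 'b::zero) \<Rightarrow> 'a \<Rightarrow> 'b" where "lookup \<equiv> Poly_Mapping.lookup"
abbreviation single :: "'a \<Rightarrow> 'b \<Rightarrow> ('a \<Rightarrow>\<^sub>0 'b::zero)" where "single \<equiv> Poly_Mapping.single"

section \<open>Subrings, submodules and the polynomial rings\<close>

text \<open>
  Several coefficient rings occur together, each inside an ambient type: \<open>K[V]\<close> for different sets
  \<open>V\<close> of indeterminates, and \<open>K[V][x]\<close>. Closure of a subset of the type is all that the arguments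
  use, so these rings and their modules are sets and not records with a carrier. In particular
  \<open>is_submodule UNIV Z\<close> says that \<open>Z\<close> is an ideal of the ambient ring.
\<close>

definition is_subring :: "'r::comm_ring_1 set \<Rightarrow> bool" where
  "is_subring R \<longleftrightarrow> 1 \<in> R \<and> (\<forall>x\<in>R. \<forall>y\<in>R. x - y \<in> R \<and> x * y \<in> R)"

definition is_submodule :: "'r::comm_ring_1 set \<Rightarrow> 'r set \<Rightarrow> bool" where
  "is_submodule R M \<longleftrightarrow> 0 \<in> M \<and> (\<forall>x\<in>M. \<forall>y\<in>M. x + y \<in> M) \<and> (\<forall>r\<in>R. \<forall>x\<in>M. r * x \<in> M)"

lemma is_subring_closed:
  assumes "is_subring R"
  shows is_subring_one: "1 \<in> R" and is_subring_zero: "0 \<in> R"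
    and is_subring_diff: "x \<in> R \<Longrightarrow> y \<in> R \<Longrightarrow> x - y \<in> R"
    and is_subring_uminus: "x \<in> R \<Longrightarrow> - x \<in> R"
    and is_subring_add: "x \<in> R \<Longrightarrow> y \<in> R \<Longrightarrow> x + y \<in> R"
    and is_subring_mult: "x \<in> R \<Longrightarrow> y \<in> R \<Longrightarrow> x * y \<in> R"
proof -
  have d: "x - y \<in> R" if "x \<in> R" "y \<in> R" for x y
    using assms by (auto simp: is_subring_def that)
  show "1 \<in> R" using assms by (simp add: is_subring_def)
  then show z: "0 \<in> R" using d[of 1 1] by simp
  have u: "- x \<in> R" if "x \<in> R" for x using d[OF z that] by simp
  show "x \<in> R \<Longrightarrow> y \<in> R \<Longrightarrow> x - y \<in> R" "x \<in> R \<Longrightarrow> - x \<in> R" by (fact d, fact u)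
  show "x \<in> R \<Longrightarrow> y \<in> R \<Longrightarrow> x + y \<in> R" using d[of x "- y"] u[of y] by simp
  show "x \<in> R \<Longrightarrow> y \<in> R \<Longrightarrow> x * y \<in> R" using assms by (simp add: is_subring_def)
qed

lemma is_subring_sum:
  assumes "is_subring R" "\<And>x. x \<in> A \<Longrightarrow> f x \<in> R"
  shows "sum f A \<in> R"
  using assms(2) by (induction A rule: infinite_finite_induct)
    (simp_all add: is_subring_zero[OF assms(1)] is_subring_add[OF assms(1)])

lemma is_subring_prod:
  assumes "is_subring R" "\<And>x. x \<in> A \<Longrightarrow> f x \<in> R"
  shows "prod f A \<in> R"
  using assms(2) by (induction A rule: infinite_finite_induct)
    (simp_all add: is_subring_one[OF assms(1)] is_subring_mult[OF assms(1)])

lemma is_subring_power: "is_subring R \<Longrightarrow> x \<in> R \<Longrightarrow> x ^ n \<in> R"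
  by (induction n) (simp_all add: is_subring_one is_subring_mult)

lemma is_subring_UNIV: "is_subring UNIV"
  by (simp add: is_subring_def)

lemma is_submodule_closed:
  assumes "is_submodule R M"
  shows is_submodule_zero: "0 \<in> M"
    and is_submodule_add: "x \<in> M \<Longrightarrow> y \<in> M \<Longrightarrow> x + y \<in> M"
    and is_submodule_mult: "r \<in> R \<Longrightarrow> x \<in> M \<Longrightarrow> r * x \<in> M"
  using assms by (simp_all add: is_submodule_def)

lemma is_submodule_sum:
  assumes "is_submodule R M" "\<And>x. x \<in> A \<Longrightarrow> f x \<in> M"
  shows "sum f A \<in> M"
  using assms(2) by (induction A rule: infinite_finite_induct)
    (simp_all add: is_submodule_zero[OF assms(1)] is_submodule_add[OF assms(1)])

lemma is_submodule_uminus: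
  assumes "is_submodule R M" "is_subring R" "x \<in> M"
  shows "- x \<in> M"
  using is_submodule_mult[OF assms(1) is_subring_uminus[OF assms(2) is_subring_one[OF assms(2)]] assms(3)]
  by simp

lemma is_submodule_diff:
  assumes "is_submodule R M" "is_subring R" "x \<in> M" "y \<in> M"
  shows "x - y \<in> M"
  using is_submodule_add[OF assms(1,3) is_submodule_uminus[OF assms(1,2,4)]] by simp

lemma poly_expand_superset:
  assumes "finite A" "keys f \<subseteq> A"
  shows "f = (\<Sum>m\<in>A. single m (lookup f m))"
proof (rule poly_mapping_eqI)
  fix k
  show "lookup f k = lookup (\<Sum>m\<in>A. single m (lookup f m)) k"
    using assms by (auto simp: lookup_sum lookup_single when_def in_keys_iff)
qed

lemmas poly_expand = poly_expand_superset[OF finite_keys subset_refl]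

lemma mult_expand:
  "f * g = (\<Sum>m\<in>keys f. \<Sum>n\<in>keys g. single (m + n) (lookup f m * lookup g n))"
  by (subst poly_expand[of f], subst poly_expand[of g]) (simp add: sum_product mult_single)

lemma lookup_const_mult: "lookup (single 0 c * f) t = c * lookup f t"
  for f :: "'a::comm_monoid_add \<Rightarrow>\<^sub>0 'r::comm_ring_1"
proof -
  have "single 0 c * f = (\<Sum>m\<in>keys f. single m (c * lookup f m))"
    by (subst poly_expand[of f]) (simp only: sum_distrib_left mult_single add_0)
  then show ?thesis by (simp add: lookup_sum lookup_single when_def in_keys_iff)
qed

text \<open>
  By bilinearity, multiplicativity needs to be checked on single terms only.
\<close>

lemma additive_mult_hom:
  fixes F :: "('a::comm_monoid_add \<Rightarrow>\<^sub>0 'r::comm_ring_1) \<Rightarrow> 's::comm_ring_1"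
  assumes "additive F"
    and F: "\<And>m n c d. F (single (m + n) (c * d)) = F (single m c) * F (single n d)"
  shows "F (f * g) = F f * F g"
proof -
  have *: "F f = (\<Sum>m\<in>keys f. F (single m (lookup f m)))" for f
    unfolding additive.sum[OF assms(1), symmetric] by (simp only: poly_expand[symmetric])
  have "F (f * g) = (\<Sum>m\<in>keys f. \<Sum>n\<in>keys g. F (single m (lookup f m)) * F (single n (lookup g n)))"
    unfolding mult_expand[of f g] by (simp only: additive.sum[OF assms(1)] F)
  then show ?thesis
    unfolding *[of f] *[of g] by (simp only: sum_product)
qed

lemma is_subring_coeffs_in:
  assumes "is_subring R"
  shows "is_subring (coeffs_in R :: ('n, 'r::comm_ring_1) mpoly set)"
proof -
  note R = is_subring_closed[OF assms]
  have s: "(\<Sum>x\<in>A. g x) \<in> coeffs_in R" if "\<And>x. x \<in> A \<Longrightarrow> g x \<in> coeffs_in R"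
    for A and g :: "'b \<Rightarrow> ('n, 'r) mpoly"
    using that by (auto simp: coeffs_in_def lookup_sum intro!: is_subring_sum[OF assms])
  have "f * g \<in> coeffs_in R" if "f \<in> coeffs_in R" "g \<in> coeffs_in R" for f g :: "('n, 'r) mpoly"
    unfolding mult_expand
    using that by (intro s) (auto simp: coeffs_in_def lookup_single when_def R)
  then show ?thesis
    by (auto simp: is_subring_def coeffs_in_def lookup_minus lookup_one when_def R)
qed

lemma single_in_coeffs_in:
  "is_subring R \<Longrightarrow> c \<in> R \<Longrightarrow> single m c \<in> coeffs_in R"
  by (auto simp: coeffs_in_def lookup_single when_def is_subring_zero)

lemma is_subring_polys_in: "is_subring (polys_in V :: ('v, 'r::comm_ring_1) mpoly set)"
proof -
  have "p - q \<in> polys_in V" if "p \<in> polys_in V" "q \<in> polys_in V" for p q :: "('v, 'r) mpoly"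
  proof -
    have "keys (p - q) \<subseteq> keys p \<union> keys q" by (auto simp: in_keys_iff lookup_minus)
    with that show ?thesis unfolding polys_in_def by blast
  qed
  moreover have "p * q \<in> polys_in V" if "p \<in> polys_in V" "q \<in> polys_in V" for p q :: "('v, 'r) mpoly"
    unfolding polys_in_def
  proof clarsimp
    fix m v assume "m \<in> keys (p * q)" "v \<in> keys m"
    then obtain a b where "a \<in> keys p" "b \<in> keys q" "v \<in> keys (a + b)"
      using keys_mult[of p q] by auto
    then show "v \<in> V" using that keys_add[of a b] unfolding polys_in_def by blast
  qed
  moreover have "(1 :: ('v, 'r) mpoly) \<in> polys_in V" by (simp add: polys_in_def)
  ultimately show ?thesis by (simp add: is_subring_def)
qed

lemma cring_poly_ring: "cring (poly_ring V)"
proof (rule cringI)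
  note V = is_subring_closed[OF is_subring_polys_in[of V]]
  show "abelian_group (poly_ring V)"
  proof (rule abelian_groupI)
    fix x assume "x \<in> carrier (poly_ring V)"
    then show "\<exists>y\<in>carrier (poly_ring V). y \<oplus>\<^bsub>poly_ring V\<^esub> x = \<zero>\<^bsub>poly_ring V\<^esub>"
      by (intro bexI[of _ "- x"]) (simp_all add: poly_ring_def V)
  qed (simp_all add: poly_ring_def V add_ac)
  show "comm_monoid (poly_ring V)"
    by (rule comm_monoidI) (simp_all add: poly_ring_def V mult_ac)
qed (simp add: poly_ring_def distrib_right)

lemma ring_poly_ring: "ring (poly_ring V)"
  by (rule cring.axioms(1)[OF cring_poly_ring])

text \<open>
  Ideals of \<open>poly_ring V\<close> are handled as subsets of the ambient polynomial type closed under
  addition and under multiplication by \<open>polys_in V\<close>.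
\<close>

lemma ideal_poly_ring_iff:
  fixes I :: "('v, 'r::comm_ring_1) mpoly set"
  shows "ideal I (poly_ring V) \<longleftrightarrow> I \<subseteq> polys_in V \<and> is_submodule (polys_in V) I"
proof
  assume I: "ideal I (poly_ring V)"
  note I' = ideal.axioms(1)[OF I]
  show "I \<subseteq> polys_in V \<and> is_submodule (polys_in V) I"
    using additive_subgroup.a_subset[OF I'] additive_subgroup.zero_closed[OF I']
      additive_subgroup.a_closed[OF I'] ideal.I_l_closed[OF I]
    by (auto simp: poly_ring_def is_submodule_def)
next
  assume I: "I \<subseteq> polys_in V \<and> is_submodule (polys_in V) I"
  note u = is_submodule_uminus[OF _ is_subring_polys_in]
  interpret ring "poly_ring V" by (rule ring_poly_ring)
  have inv: "inv\<^bsub>add_monoid (poly_ring V)\<^esub> x = - x" if "x \<in> I" for x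
    using that I u[of V I x] unfolding a_inv_def[symmetric]
    by (intro minus_equality[symmetric, THEN sym]) (auto simp: poly_ring_def)
  show "ideal I (poly_ring V)"
  proof (rule idealI[OF ring_poly_ring])
    show "subgroup I (add_monoid (poly_ring V))"
    proof (rule subgroup.intro)
      fix x assume "x \<in> I"
      then show "inv\<^bsub>add_monoid (poly_ring V)\<^esub> x \<in> I" using I inv u by metis
    qed (use I in \<open>auto simp: poly_ring_def is_submodule_def\<close>)
  next
    fix a x :: "('v, 'r) mpoly"
    assume "a \<in> I" "x \<in> carrier (poly_ring V)"
    then have "x * a \<in> I" using I by (simp add: poly_ring_def is_submodule_def)
    then show "x \<otimes>\<^bsub>poly_ring V\<^esub> a \<in> I" "a \<otimes>\<^bsub>poly_ring V\<^esub> x \<in> I"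
      by (simp_all add: poly_ring_def mult.commute)
  qed
qed

lemma genideal_poly_ring:
  assumes "S \<subseteq> polys_in V"
  shows ideal_genideal: "ideal (Idl\<^bsub>poly_ring V\<^esub> S) (poly_ring V)"
    and genideal_superset: "S \<subseteq> Idl\<^bsub>poly_ring V\<^esub> S"
    and genideal_least: "I \<subseteq> polys_in V \<Longrightarrow> is_submodule (polys_in V) I \<Longrightarrow> S \<subseteq> I \<Longrightarrow>
           Idl\<^bsub>poly_ring V\<^esub> S \<subseteq> I"
proof -
  interpret ring "poly_ring V" by (rule ring_poly_ring)
  have c: "S \<subseteq> carrier (poly_ring V)" using assms by (simp add: poly_ring_def)
  show "ideal (Idl\<^bsub>poly_ring V\<^esub> S) (poly_ring V)" "S \<subseteq> Idl\<^bsub>poly_ring V\<^esub> S"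
    using genideal_ideal[OF c] genideal_self[OF c] by auto
  show "I \<subseteq> polys_in V \<Longrightarrow> is_submodule (polys_in V) I \<Longrightarrow> S \<subseteq> I \<Longrightarrow> Idl\<^bsub>poly_ring V\<^esub> S \<subseteq> I"
    using genideal_minimal ideal_poly_ring_iff by blast
qed

section \<open>Substitution homomorphisms\<close>

definition unital_hom :: "('r::comm_ring_1 \<Rightarrow> 's::comm_ring_1) \<Rightarrow> bool" where
  "unital_hom h \<longleftrightarrow> h 1 = 1 \<and> (\<forall>x y. h (x + y) = h x + h y) \<and> (\<forall>x y. h (x * y) = h x * h y)"

lemma unital_hom_props:
  assumes "unital_hom h"
  shows "additive h" "h 1 = 1" "h 0 = 0" "h (x + y) = h x + h y" "h (x - y) = h x - h y"
    "h (x * y) = h x * h y" "h (sum g A) = (\<Sum>x\<in>A. h (g x))"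
proof -
  show *: "additive h" using assms by (simp add: unital_hom_def additive_def)
  show "h 1 = 1" "h 0 = 0" "h (x + y) = h x + h y" "h (x - y) = h x - h y"
    "h (x * y) = h x * h y" "h (sum g A) = (\<Sum>x\<in>A. h (g x))"
    using assms additive.zero[OF *] additive.diff[OF *] additive.sum[OF *]
    by (auto simp: unital_hom_def)
qed

definition term_value :: "('v \<Rightarrow> 's::comm_ring_1) \<Rightarrow> 'v monom \<Rightarrow> 's" where
  "term_value a m = (\<Prod>v\<in>keys m. a v ^ lookup m v)"

definition subst_poly ::
    "('r::comm_ring_1 \<Rightarrow> 's::comm_ring_1) \<Rightarrow> ('v \<Rightarrow> 's) \<Rightarrow> ('v, 'r) mpoly \<Rightarrow> 's" where
  "subst_poly h a p = (\<Sum>m\<in>keys p. h (lookup p m) * term_value a m)"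

lemma term_value_superset:
  assumes "finite A" "keys m \<subseteq> A"
  shows "term_value a m = (\<Prod>v\<in>A. a v ^ lookup m v)"
  unfolding term_value_def
  using assms by (intro prod.mono_neutral_left) (auto simp: in_keys_iff)

lemma term_value_add: "term_value a (m + n) = term_value a m * term_value a n"
proof -
  let ?A = "keys m \<union> keys n"
  have "term_value a (m + n) = (\<Prod>v\<in>?A. a v ^ lookup (m + n) v)"
    by (rule term_value_superset) (auto simp: keys_add)
  also have "\<dots> = (\<Prod>v\<in>?A. a v ^ lookup m v) * (\<Prod>v\<in>?A. a v ^ lookup n v)"
    by (simp add: lookup_add power_add prod.distrib)
  also have "\<dots> = term_value a m * term_value a n"
    by (subst (1 2) term_value_superset[of ?A]) auto
  finally show ?thesis .
qed

lemma term_value_indet: "term_value a (indet v) = a v"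
  by (simp add: term_value_def indet_def)

lemma subst_poly_superset:
  assumes "h 0 = 0" "finite A" "keys p \<subseteq> A"
  shows "subst_poly h a p = (\<Sum>m\<in>A. h (lookup p m) * term_value a m)"
  unfolding subst_poly_def
  using assms by (intro sum.mono_neutral_left) (auto simp: in_keys_iff)

lemma subst_poly_single:
  assumes "unital_hom h"
  shows "subst_poly h a (single m c) = h c * term_value a m"
  by (simp add: subst_poly_def unital_hom_props[OF assms])

lemma unital_hom_subst_poly:
  assumes h: "unital_hom h"
  shows "unital_hom (subst_poly h a)"
proof -
  note hp = unital_hom_props[OF h]
  have add: "subst_poly h a (p + q) = subst_poly h a p + subst_poly h a q" for p q
  proof -
    let ?A = "keys p \<union> keys q"
    have "subst_poly h a (p + q) = (\<Sum>m\<in>?A. h (lookup (p + q) m) * term_value a m)"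
      by (rule subst_poly_superset) (auto simp: keys_add hp)
    also have "\<dots> = (\<Sum>m\<in>?A. h (lookup p m) * term_value a m) + (\<Sum>m\<in>?A. h (lookup q m) * term_value a m)"
      by (simp add: lookup_add hp distrib_right sum.distrib)
    also have "\<dots> = subst_poly h a p + subst_poly h a q"
      by (subst (1 2) subst_poly_superset[of h ?A]) (auto simp: hp)
    finally show ?thesis .
  qed
  then have "subst_poly h a (p * q) = subst_poly h a p * subst_poly h a q" for p q
    by (intro additive_mult_hom)
      (simp_all add: additive_def subst_poly_single[OF h] hp term_value_add mult_ac)
  moreover have "subst_poly h a 1 = 1"
    using subst_poly_single[OF h, of a 0 1] by (simp add: term_value_def hp)
  ultimately show ?thesis using add by (simp add: unital_hom_def)
qed

lemma subst_poly_indet: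
  assumes "unital_hom h"
  shows "subst_poly h a (single (indet v) 1) = a v"
  by (simp add: subst_poly_single term_value_indet unital_hom_props[OF assms] assms)

lemma unital_hom_const: "unital_hom (const :: 'r::comm_ring_1 \<Rightarrow> ('v, 'r) mpoly)"
  by (simp add: unital_hom_def const_def single_add mult_single)

lemma subst_poly_const_in_polys_in:
  fixes a :: "'v \<Rightarrow> ('w, 'r::comm_ring_1) mpoly"
  assumes "p \<in> polys_in V" "\<And>v. v \<in> V \<Longrightarrow> a v \<in> polys_in W"
  shows "subst_poly const a p \<in> polys_in W"
proof -
  note W = is_subring_polys_in[of W]
  have "const c \<in> (polys_in W :: ('w, 'r) mpoly set)" for c
    by (simp add: polys_in_def const_def)
  then show ?thesis unfolding subst_poly_def term_value_def using assms
    by (intro is_subring_sum[OF W] is_subring_mult[OF W] is_subring_prod[OF W] is_subring_power[OF W])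
       (auto simp: polys_in_def[of V])
qed

lemma single_indet_power: "single (indet v) (1::'r::comm_ring_1) ^ n = single (single v n) 1"
proof (induction n)
  case (Suc n)
  then show ?case by (simp add: mult_single indet_def single_add[symmetric])
qed simp

lemma prod_single_one: "(\<Prod>x\<in>A. single (g x) (1::'r::comm_ring_1)) = single (sum g A) 1"
  by (induction A rule: infinite_finite_induct) (simp_all add: mult_single)

text \<open>
  This is applied to homomorphisms that move some indeterminates but fix those in \<open>V\<close>.
\<close>

lemma subst_poly_ident:
  fixes p :: "('v, 'r::comm_ring_1) mpoly"
  assumes "p \<in> polys_in V" "\<And>v. v \<in> V \<Longrightarrow> a v = single (indet v) 1"
  shows "subst_poly const a p = p"
proof -
  have "term_value a m = single m (1::'r)" if "m \<in> keys p" for m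
  proof -
    have "term_value a m = (\<Prod>v\<in>keys m. single (single v (lookup m v)) (1::'r))"
      unfolding term_value_def
    proof (rule prod.cong)
      fix v assume "v \<in> keys m"
      then have "v \<in> V" using assms(1) that by (auto simp: polys_in_def)
      then show "a v ^ lookup m v = single (single v (lookup m v)) 1"
        by (simp add: assms(2) single_indet_power)
    qed simp
    also have "\<dots> = single m 1" by (simp add: prod_single_one poly_expand[symmetric])
    finally show ?thesis .
  qed
  then have "subst_poly const a p = (\<Sum>m\<in>keys p. single m (lookup p m))"
    unfolding subst_poly_def by (intro sum.cong) (simp_all add: const_def mult_single)
  then show ?thesis by (simp add: poly_expand[symmetric])
qed

lemma eval_mpoly_conv_subst_poly: "eval_mpoly a = subst_poly (\<lambda>c. c) a"
  by (simp add: fun_eq_iff eval_mpoly_def subst_poly_def term_value_def)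

lemma unital_hom_ident: "unital_hom (\<lambda>c. c)"
  by (simp add: unital_hom_def)

lemma unital_hom_eval_mpoly: "unital_hom (eval_mpoly a)"
  unfolding eval_mpoly_conv_subst_poly by (rule unital_hom_subst_poly[OF unital_hom_ident])

lemma eval_mpoly_indet: "eval_mpoly a (single (indet v) 1) = a v"
  unfolding eval_mpoly_conv_subst_poly by (rule subst_poly_indet[OF unital_hom_ident])

lemma eval_mpoly_cpoly: "eval_mpoly a (cpoly t b) = a (t, b)"
  by (simp add: cpoly_def eval_mpoly_indet)

lemma lookup_specialize: "lookup (specialize a f) m = eval_mpoly a (lookup f m)"
  using unital_hom_props(3)[OF unital_hom_eval_mpoly[of a]]
  by (simp add: specialize_def map.rep_eq when_def)

lemma specialize_single: "specialize a (single m c) = single m (eval_mpoly a c)"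
  by (rule poly_mapping_eqI)
    (simp add: lookup_specialize lookup_single when_def unital_hom_props[OF unital_hom_eval_mpoly])

lemma unital_hom_specialize: "unital_hom (specialize (a :: 'n cvar \<Rightarrow> 'k::field))"
proof -
  note e = unital_hom_props[OF unital_hom_eval_mpoly[of a]]
  have add: "specialize a (f + g) = specialize a f + specialize a g" for f g :: "('n, ('n cvar, 'k) mpoly) mpoly"
    by (rule poly_mapping_eqI) (simp add: lookup_specialize lookup_add e)
  have "specialize a (f * g) = specialize a f * specialize a g" for f g :: "('n, ('n cvar, 'k) mpoly) mpoly"
    by (rule additive_mult_hom) (simp_all add: additive_def add specialize_single mult_single e)
  moreover have "specialize a (1 :: ('n, ('n cvar, 'k) mpoly) mpoly) = 1"
    using specialize_single[of a 0 1] by (simp add: e)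
  ultimately show ?thesis using add by (simp add: unital_hom_def)
qed

section \<open>Term orderings are well-founded\<close>

text \<open>
  A monotone subsequence of naturals that is not increasing is decreasing, and constant from its
  minimum on.
\<close>

lemma incseq_subseq_nat:
  fixes s :: "nat \<Rightarrow> nat"
  obtains g where "strict_mono g" "incseq (\<lambda>i. s (g i))"
proof -
  obtain g where g: "strict_mono g" "monoseq (\<lambda>n. s (g n))"
    using seq_monosub by blast
  show thesis
  proof (cases "incseq (\<lambda>n. s (g n))")
    case False
    then have dec: "decseq (\<lambda>n. s (g n))" using g(2) by (simp add: monoseq_iff)
    obtain N where N: "\<And>n. s (g N) \<le> s (g n)"
      using ex_has_least_nat[of "\<lambda>_. True" undefined "\<lambda>n. s (g n)"] by auto
    have "s (g (N + n)) = s (g N)" for n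
      using decseqD[OF dec, of N "N + n"] N[of "N + n"] by simp
    then have "incseq (\<lambda>n. s (g (N + n)))" by (simp add: incseq_def)
    moreover have "strict_mono (\<lambda>n. g (N + n))"
      using g(1) by (simp add: strict_mono_def)
    ultimately show thesis using that by blast
  qed (use g(1) that in blast)
qed

lemma incseq_subseq_all:
  fixes f :: "nat \<Rightarrow> 'n monom"
  assumes "finite A"
  shows "\<exists>g. strict_mono g \<and> (\<forall>v\<in>A. incseq (\<lambda>i. lookup (f (g i)) v))"
  using assms
proof (induction A)
  case empty
  show ?case by (intro exI[of _ id]) (simp add: strict_mono_def)
next
  case (insert v A)
  then obtain g where g: "strict_mono g" "\<forall>w\<in>A. incseq (\<lambda>i. lookup (f (g i)) w)"
    by blast
  obtain h where h: "strict_mono h" "incseq (\<lambda>i. lookup (f (g (h i))) v)"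
    using incseq_subseq_nat[of "\<lambda>i. lookup (f (g i)) v"] by blast
  have "incseq (\<lambda>i. lookup (f (g (h i))) w)" if "w \<in> A" for w
    using g(2) that strict_mono_mono[OF h(1)] by (auto simp: incseq_def mono_def)
  with h show ?case using g(1)
    by (intro exI[of _ "g \<circ> h"]) (auto simp: strict_mono_def)
qed

lemma tdvd_iff: "tdvd s t \<longleftrightarrow> (\<forall>v. lookup s v \<le> lookup t v)"
proof
  assume le: "\<forall>v. lookup s v \<le> lookup t v"
  have "t = s + (t - s)"
    by (rule poly_mapping_eqI) (use le in \<open>simp add: lookup_add lookup_minus\<close>)
  then show "tdvd s t" unfolding tdvd_def by blast
qed (auto simp: tdvd_def lookup_add)

text \<open>
  Passing to a subsequence once for each of the finitely many indeterminates makes all exponents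
  weakly increasing along it.
\<close>

lemma dickson:
  fixes f :: "nat \<Rightarrow> 'n::finite monom"
  shows "\<exists>i j. i < j \<and> tdvd (f i) (f j)"
proof -
  obtain g where g: "strict_mono g" "\<forall>v. incseq (\<lambda>i. lookup (f (g i)) v)"
    using incseq_subseq_all[of UNIV f] by auto
  have "g 0 < g 1" using g(1) by (simp add: strict_mono_def)
  moreover have "tdvd (f (g 0)) (f (g 1))" using g(2) by (auto simp: tdvd_iff incseq_def)
  ultimately show ?thesis by blast
qed

lemma indet_split:
  assumes "k \<in> keys m"
  obtains m' where "m = indet k + m'"
proof -
  have "tdvd (indet k) m"
    using assms by (auto simp: tdvd_iff indet_def lookup_single when_def in_keys_iff)
  then show thesis using that by (auto simp: tdvd_def)
qed

locale term_order =
  fixes \<sigma> :: "'n::finite monom rel"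
  assumes term_ordering: "term_ordering \<sigma>"
begin

abbreviation le (infix "\<preceq>" 50) where "s \<preceq> t \<equiv> (s, t) \<in> \<sigma>"
abbreviation less (infix "\<prec>" 50) where "s \<prec> t \<equiv> term_less \<sigma> s t"

lemma le_refl: "t \<preceq> t" and zero_le: "0 \<preceq> t"
  and le_antisym: "s \<preceq> t \<Longrightarrow> t \<preceq> s \<Longrightarrow> s = t"
  and le_trans: "s \<preceq> t \<Longrightarrow> t \<preceq> u \<Longrightarrow> s \<preceq> u"
  and le_linear: "s \<preceq> t \<or> t \<preceq> s"
  and add_le: "s \<preceq> t \<Longrightarrow> s + u \<preceq> t + u"
proof -
  have *: "refl \<sigma>" "trans \<sigma>" "antisym \<sigma>" "total \<sigma>" "\<And>t. 0 \<preceq> t"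
    "\<And>s t u. s \<preceq> t \<Longrightarrow> s + u \<preceq> t + u"
    using term_ordering
    by (auto simp: term_ordering_def linear_order_on_def partial_order_on_def preorder_on_def)
  show refl: "t \<preceq> t" for t using *(1) by (simp add: refl_on_def)
  show "0 \<preceq> t" "s \<preceq> t \<Longrightarrow> s + u \<preceq> t + u" using *(5,6) by blast+
  show "s \<preceq> t \<Longrightarrow> t \<preceq> s \<Longrightarrow> s = t" using *(3) by (auto dest: antisymD)
  show "s \<preceq> t \<Longrightarrow> t \<preceq> u \<Longrightarrow> s \<preceq> u" using *(2) by (auto dest: transD)
  show "s \<preceq> t \<or> t \<preceq> s" using *(4) refl by (cases "s = t") (auto simp: total_on_def)
qed

lemma less_le_trans: "s \<prec> t \<Longrightarrow> t \<preceq> u \<Longrightarrow> s \<prec> u"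
  and less_irrefl: "\<not> t \<prec> t"
  and not_le_iff: "\<not> s \<preceq> t \<longleftrightarrow> t \<prec> s"
  and le_iff: "s \<preceq> t \<longleftrightarrow> s \<prec> t \<or> s = t"
  unfolding term_less_def using le_refl le_antisym le_trans le_linear by blast+

lemma less_imp_le: "s \<prec> t \<Longrightarrow> s \<preceq> t"
  by (simp add: le_iff)

lemma add_less: "s \<prec> t \<Longrightarrow> u + s \<prec> u + t"
  using add_le[of s t u] by (auto simp: term_less_def add.commute)

lemma add_le_left: "s \<preceq> t \<Longrightarrow> u + s \<preceq> u + t"
  using add_le[of s t u] by (simp add: add.commute)

lemma tdvd_le: "tdvd s t \<Longrightarrow> s \<preceq> t"
  unfolding tdvd_def using add_le_left[OF zero_le] by fastforce

lemma less_indet_add: "t \<prec> indet k + t"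
proof -
  have "lookup (indet k) k \<noteq> 0" by (simp add: indet_def)
  then have "indet k \<noteq> 0" by auto
  then show ?thesis using add_le[of 0 "indet k" t] zero_le by (auto simp: term_less_def)
qed

text \<open>
  A term ordering refines divisibility, so a strictly descending chain of terms would contradict
  Dickson's lemma.
\<close>

lemma wf_less: "wf {(s, t). s \<prec> t}"
  unfolding wf_iff_no_infinite_down_chain
proof
  assume "\<exists>f. \<forall>i. (f (Suc i), f i) \<in> {(s, t). s \<prec> t}"
  then obtain f where f: "\<And>i. f (Suc i) \<prec> f i" by blast
  have desc: "i < j \<Longrightarrow> f j \<prec> f i" for i j
  proof (induction j)
    case (Suc j)
    then show ?case using f[of j] less_le_trans[OF f less_imp_le] by (cases "i = j") auto
  qed simp
  obtain i j where "i < j" "tdvd (f i) (f j)" using dickson by blast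
  then show False using desc tdvd_le not_le_iff by blast
qed

lemma ex_max:
  assumes "finite A" "A \<noteq> {}"
  shows "\<exists>t\<in>A. \<forall>s\<in>A. s \<preceq> t"
  using assms
proof (induction A rule: finite_ne_induct)
  case (insert x A)
  then show ?case by (metis insert_iff le_linear le_refl le_trans)
qed (simp add: le_refl)

lemma leading_term_eq:
  assumes "t \<in> keys f" "\<And>s. s \<in> keys f \<Longrightarrow> s \<preceq> t"
  shows "leading_term \<sigma> f = t"
  unfolding leading_term_def using assms le_antisym by (intro the_equality) blast+

lemma leading_term:
  assumes "f \<noteq> 0"
  shows leading_term_in_keys: "leading_term \<sigma> f \<in> keys f"
    and le_leading_term: "s \<in> keys f \<Longrightarrow> s \<preceq> leading_term \<sigma> f"
proof -
  have "keys f \<noteq> {}" using assms by simp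
  then obtain t where t: "t \<in> keys f" "\<And>s. s \<in> keys f \<Longrightarrow> s \<preceq> t"
    using ex_max[OF finite_keys] by blast
  then have "leading_term \<sigma> f = t" by (rule leading_term_eq)
  with t show "leading_term \<sigma> f \<in> keys f" "s \<in> keys f \<Longrightarrow> s \<preceq> leading_term \<sigma> f"
    by simp_all
qed

end

section \<open>Normal forms modulo an order ideal\<close>

locale order_ideal_with_order = term_order \<sigma> for \<sigma> :: "'n::finite monom rel" +
  fixes \<O> :: "'n monom set"
  assumes order_ideal: "order_ideal \<O>" and nonempty: "\<O> \<noteq> {}"
begin

lemma finite_O: "finite \<O>" and dvd_closed: "t \<in> \<O> \<Longrightarrow> tdvd s t \<Longrightarrow> s \<in> \<O>"
  using order_ideal by (auto simp: order_ideal_def)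

lemma zero_in_O: "0 \<in> \<O>"
  using nonempty dvd_closed by (auto simp: tdvd_def)

lemma corner_not_in_O: "b \<in> corners \<O> \<Longrightarrow> b \<notin> \<O>"
  by (simp add: corners_def)

text \<open>
  A \<open>\<sigma>\<close>-minimal term among the divisors of \<open>m\<close> outside \<open>\<O>\<close> is also minimal for divisibility.
\<close>

lemma corner_dvd:
  assumes "m \<notin> \<O>"
  obtains b u where "b \<in> corners \<O>" "m = b + u"
proof -
  let ?D = "{s. s \<notin> \<O> \<and> tdvd s m}"
  have "m \<in> ?D" using assms by (simp add: tdvd_iff)
  then obtain b where b: "b \<in> ?D" "\<And>s. s \<prec> b \<Longrightarrow> s \<notin> ?D"
    by (rule wfE_min[OF wf_less]) auto
  have "s = b" if "s \<notin> \<O>" "tdvd s b" for s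
  proof -
    have "tdvd s m" using b(1) that(2) le_trans by (force simp: tdvd_iff intro: order_trans)
    then show ?thesis using b(2)[of s] that tdvd_le[of s b] by (auto simp: le_iff)
  qed
  then have "b \<in> corners \<O>" using b(1) by (simp add: corners_def)
  moreover obtain u where "m = b + u" using b(1) by (auto simp: tdvd_def)
  ultimately show thesis by (rule that)
qed

text \<open>
  Minimality puts every quotient of \<open>b\<close> by one of its indeterminates into \<open>\<O>\<close>. There is such an
  indeterminate because \<open>\<O>\<close> is nonempty: for the empty order ideal the term \<open>1\<close> would be a corner.
\<close>

lemma corner_border:
  assumes "b \<in> corners \<O>"
  obtains k s where "s \<in> \<O>" "b = indet k + s"
proof -
  have "b \<noteq> 0" using assms zero_in_O corner_not_in_O by auto
  then obtain k where "k \<in> keys b" by (metis keys_eq_empty all_not_in_conv)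
  then obtain s where s: "b = indet k + s" by (rule indet_split)
  have "s \<in> \<O>"
  proof (rule ccontr)
    assume "s \<notin> \<O>"
    moreover have "tdvd s b" using s by (auto simp: tdvd_def add.commute)
    ultimately have "s = b" using assms by (auto simp: corners_def)
    then show False using s less_indet_add[of s k] by (simp add: less_irrefl)
  qed
  with s that show thesis by blast
qed

lemma corners_subset_border: "corners \<O> \<subseteq> border \<O>"
proof
  fix b assume b: "b \<in> corners \<O>"
  then obtain k s where "s \<in> \<O>" "b = indet k + s" by (rule corner_border)
  with corner_not_in_O[OF b] show "b \<in> border \<O>" by (auto simp: border_def)
qed

lemma finite_corners: "finite (corners \<O>)"
  using finite_subset[OF corners_subset_border] finite_O by (simp add: border_def)

text \<open>
  Normal forms of the terms of \<open>p\<close> combine linearly to a normal form of \<open>p\<close>. The set \<open>A\<close> of allowed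
  terms is a parameter because the bound by \<open>\<sigma>\<close> has to be carried along in the recursion below.
\<close>

lemma replace_terms:
  fixes G :: "('n, 'r::comm_ring_1) mpoly set"
  assumes R: "is_subring R" and G: "is_submodule (coeffs_in R) G" and p: "p \<in> coeffs_in R"
    and ex: "\<And>s. s \<in> keys p \<Longrightarrow> \<exists>f\<in>coeffs_in R. keys f \<subseteq> A \<and> single s 1 - f \<in> G"
  shows "\<exists>f\<in>coeffs_in R. keys f \<subseteq> A \<and> p - f \<in> G"
proof -
  note RX = is_subring_coeffs_in[OF R]
  obtain W where W: "\<And>s. s \<in> keys p \<Longrightarrow>
      W s \<in> coeffs_in R \<and> keys (W s) \<subseteq> A \<and> single s 1 - W s \<in> G"
    using ex by metis
  define h where "h = (\<Sum>s\<in>keys p. single 0 (lookup p s) * W s)"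
  have c: "single 0 (lookup p s) \<in> coeffs_in R" for s
    using p by (intro single_in_coeffs_in[OF R]) (auto simp: coeffs_in_def)
  have "h \<in> coeffs_in R"
    unfolding h_def using c W by (intro is_subring_sum[OF RX] is_subring_mult[OF RX]) auto
  moreover have "keys h \<subseteq> A"
  proof
    fix t assume "t \<in> keys h"
    then obtain s where s: "s \<in> keys p" "lookup (single 0 (lookup p s) * W s) t \<noteq> 0"
      unfolding h_def in_keys_iff lookup_sum using sum.not_neutral_contains_not_neutral by blast
    then have "t \<in> keys (W s)"
      using keys_mult[of "single 0 (lookup p s)" "W s"] by (auto simp: in_keys_iff split: if_splits)
    with W[OF s(1)] show "t \<in> A" by blast
  qed
  moreover have "p - h \<in> G"
  proof -
    have "p = (\<Sum>s\<in>keys p. single 0 (lookup p s) * single s 1)"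
      by (simp add: mult_single poly_expand[symmetric])
    then have "p - h = (\<Sum>s\<in>keys p. single 0 (lookup p s) * single s 1) - h" by simp
    also have "\<dots> = (\<Sum>s\<in>keys p. single 0 (lookup p s) * (single s 1 - W s))"
      by (simp add: h_def right_diff_distrib sum_subtractf)
    also have "\<dots> \<in> G"
      using c W by (intro is_submodule_sum[OF G] is_submodule_mult[OF G]) auto
    finally show ?thesis .
  qed
  ultimately show ?thesis by blast
qed

text \<open>
  Division with remainder. It suffices that every term outside \<open>\<O>\<close> can be rewritten by smaller terms,
  wherever these lie: the smaller terms have normal forms by well-founded induction.
\<close>

lemma normal_form_term:
  fixes G :: "('n, 'r::comm_ring_1) mpoly set"
  assumes R: "is_subring R" and G: "is_submodule (coeffs_in R) G"
    and step: "\<And>m. m \<notin> \<O> \<Longrightarrow>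
      \<exists>f\<in>coeffs_in R. (\<forall>s\<in>keys f. s \<prec> m) \<and> single m 1 - f \<in> G"
  shows "\<exists>f\<in>coeffs_in R. keys f \<subseteq> {t \<in> \<O>. t \<preceq> m} \<and> single m 1 - f \<in> G"
proof (induction m rule: wf_induct_rule[OF wf_less])
  case (1 m)
  show ?case
  proof (cases "m \<in> \<O>")
    case True
    then show ?thesis
      by (intro bexI[of _ "single m 1"])
        (auto simp: le_refl is_submodule_zero[OF G] single_in_coeffs_in[OF R] is_subring_one[OF R])
  next
    case False
    then obtain f where f: "f \<in> coeffs_in R" "\<And>s. s \<in> keys f \<Longrightarrow> s \<prec> m" "single m 1 - f \<in> G"
      using step by blast
    have "\<exists>h\<in>coeffs_in R. keys h \<subseteq> {t \<in> \<O>. t \<preceq> m} \<and> single s 1 - h \<in> G"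
      if s: "s \<in> keys f" for s
    proof -
      have "{t \<in> \<O>. t \<preceq> s} \<subseteq> {t \<in> \<O>. t \<preceq> m}"
        using le_trans less_imp_le[OF f(2)[OF s]] by blast
      with 1[of s] f(2)[OF s] show ?thesis by blast
    qed
    then obtain h where h: "h \<in> coeffs_in R" "keys h \<subseteq> {t \<in> \<O>. t \<preceq> m}" "f - h \<in> G"
      using replace_terms[OF R G f(1)] by blast
    then have "single m 1 - h \<in> G"
      using is_submodule_add[OF G f(3)] by fastforce
    with h show ?thesis by blast
  qed
qed

text \<open>
  Multiples of the rewriting rules for the corners rewrite every term outside \<open>\<O>\<close>, since multiplication
  by a term preserves \<open>\<prec>\<close>.
\<close>

lemma corner_step:
  fixes G :: "('n, 'r::comm_ring_1) mpoly set"
  assumes R: "is_subring R" and G: "is_submodule (coeffs_in R) G"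
    and corner: "\<And>b. b \<in> corners \<O> \<Longrightarrow>
      \<exists>f\<in>coeffs_in R. (\<forall>s\<in>keys f. s \<prec> b) \<and> single b 1 - f \<in> G"
    and m: "m \<notin> \<O>"
  shows "\<exists>f\<in>coeffs_in R. (\<forall>s\<in>keys f. s \<prec> m) \<and> single m 1 - f \<in> G"
proof -
  obtain b u where b: "b \<in> corners \<O>" "m = b + u" using m by (rule corner_dvd)
  obtain f where f: "f \<in> coeffs_in R" "\<And>s. s \<in> keys f \<Longrightarrow> s \<prec> b" "single b 1 - f \<in> G"
    using corner[OF b(1)] by blast
  let ?u = "single u 1 :: ('n, 'r) mpoly"
  have u: "?u \<in> coeffs_in R" by (rule single_in_coeffs_in[OF R is_subring_one[OF R]])
  have "?u * f \<in> coeffs_in R" by (rule is_subring_mult[OF is_subring_coeffs_in[OF R] u f(1)])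
  moreover have "s \<prec> m" if s: "s \<in> keys (?u * f)" for s
  proof -
    have "keys ?u \<subseteq> {u}" by simp
    then obtain t where "t \<in> keys f" "s = u + t" using keys_mult[of ?u f] s by blast
    then show ?thesis using add_less[OF f(2), of t u] b(2) by (simp add: add.commute)
  qed
  moreover have "single m 1 - ?u * f \<in> G"
    using is_submodule_mult[OF G u f(3)] b(2) by (simp add: right_diff_distrib mult_single add.commute)
  ultimately show ?thesis by blast
qed

lemma nonleading_O_zero:
  assumes I: "nonleading_terms \<sigma> I = \<O>" and f: "f \<in> I" "keys f \<subseteq> \<O>"
  shows "f = 0"
proof (rule ccontr)
  assume "f \<noteq> 0"
  then have "leading_term \<sigma> f \<in> \<O>" using leading_term_in_keys f(2) by blast
  then show False using I f(1) \<open>f \<noteq> 0\<close> by (auto simp: nonleading_terms_def)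
qed

lemma leading_term_single_diff:
  fixes f :: "('n, 'r::comm_ring_1) mpoly"
  assumes "\<And>s. s \<in> keys f \<Longrightarrow> s \<prec> m"
  shows "single m 1 - f \<noteq> 0" and "leading_term \<sigma> (single m 1 - f) = m"
proof -
  have "m \<notin> keys f" using assms less_irrefl by blast
  then have l: "lookup (single m 1 - f) m = 1" by (simp add: lookup_minus in_keys_iff)
  then show "single m 1 - f \<noteq> 0" by auto
  show "leading_term \<sigma> (single m 1 - f) = m"
  proof (rule leading_term_eq)
    show "m \<in> keys (single m 1 - f)" using l by (simp add: in_keys_iff)
    fix s assume "s \<in> keys (single m 1 - f)"
    then have "s = m \<or> s \<in> keys f"
      by (auto simp: in_keys_iff lookup_minus lookup_single when_def split: if_splits)
    then show "s \<preceq> m" using assms less_imp_le le_refl by blast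
  qed
qed

lemma zero_dimensionalI:
  fixes I :: "('n, 'k::field) mpoly set"
  assumes "\<And>p. \<exists>f. keys f \<subseteq> \<O> \<and> p - f \<in> I"
  shows "zero_dimensional I"
proof -
  interpret m: module "\<lambda>c f. const c * f :: ('n, 'k) mpoly"
    by standard (simp_all add: algebra_simps const_def single_add mult_single mult.assoc[symmetric])
  have "f \<in> m.span ((\<lambda>t. single t 1) ` \<O>)" if f: "keys f \<subseteq> \<O>" for f
  proof -
    have "f = (\<Sum>t\<in>\<O>. const (lookup f t) * single t 1)"
      using poly_expand_superset[OF finite_O f] by (simp add: const_def mult_single)
    also have "\<dots> \<in> m.span ((\<lambda>t. single t 1) ` \<O>)"
      by (intro m.span_sum m.span_scale m.span_base imageI)
    finally show ?thesis .
  qed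
  then show ?thesis unfolding zero_dimensional_def
    using assms finite_O by (intro exI[of _ "(\<lambda>t. single t 1) ` \<O>"]) blast
qed

end

section \<open>Commuting multiplication matrices\<close>

text \<open>
  The matrices are only assumed to commute modulo an ideal \<open>Z\<close> of the coefficient ring. This covers the
  generic matrices, with \<open>Z\<close> coming from \<open>L + I(B)\<close>, and the specialised matrices over \<open>K\<close>, with
  \<open>Z = 0\<close>, and it avoids forming quotient rings. The vectors on which the matrices act are functions on
  all terms, compared on \<open>\<O>\<close> only.
\<close>

locale commuting_matrices = order_ideal_with_order \<sigma> \<O>
  for \<sigma> :: "'n::finite monom rel" and \<O> :: "'n monom set" +
  fixes A :: "'n \<Rightarrow> 'n monom \<Rightarrow> 'n monom \<Rightarrow> 'r::comm_ring_1" and Z :: "'r set"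
  assumes ideal_Z: "is_submodule UNIV Z"
    and A_inside: "s \<in> \<O> \<Longrightarrow> indet k + s \<in> \<O> \<Longrightarrow> t \<in> \<O> \<Longrightarrow> A k t s = (if t = indet k + s then 1 else 0)"
    and A_commute: "t \<in> \<O> \<Longrightarrow> s \<in> \<O> \<Longrightarrow>
      (\<Sum>u\<in>\<O>. A k t u * A l u s) - (\<Sum>u\<in>\<O>. A l t u * A k u s) \<in> Z"
begin

definition zcong (infix "\<approx>" 50) where "x \<approx> y \<longleftrightarrow> x - y \<in> Z"

lemma zcong_refl [simp]: "x \<approx> x"
  by (simp add: zcong_def is_submodule_zero[OF ideal_Z])

lemma zcong_sym: "x \<approx> y \<Longrightarrow> y \<approx> x"
  using is_submodule_uminus[OF ideal_Z is_subring_UNIV, of "x - y"] by (simp add: zcong_def)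

lemma zcong_trans [trans]: "x \<approx> y \<Longrightarrow> y \<approx> z \<Longrightarrow> x \<approx> z"
  using is_submodule_add[OF ideal_Z, of "x - y" "y - z"] by (simp add: zcong_def)

lemma zcong_mult: "x \<approx> y \<Longrightarrow> c * x \<approx> c * y"
  using is_submodule_mult[OF ideal_Z, of c "x - y"] by (simp add: zcong_def right_diff_distrib)

lemma zcong_sum: "(\<And>x. x \<in> S \<Longrightarrow> f x \<approx> g x) \<Longrightarrow> sum f S \<approx> sum g S"
  unfolding zcong_def sum_subtractf[symmetric] by (rule is_submodule_sum[OF ideal_Z])

lemma zcong_0: "x \<approx> 0 \<longleftrightarrow> x \<in> Z"
  by (simp add: zcong_def)

lemma zcong_mem: "x \<approx> y \<Longrightarrow> y \<in> Z \<Longrightarrow> x \<in> Z"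
  using zcong_trans[of x y 0] by (simp add: zcong_0)

definition vcong (infix "\<cong>\<^sub>v" 50) where "v \<cong>\<^sub>v w \<longleftrightarrow> (\<forall>t\<in>\<O>. v t \<approx> w t)"

lemma vcong_trans [trans]: "u \<cong>\<^sub>v v \<Longrightarrow> v \<cong>\<^sub>v w \<Longrightarrow> u \<cong>\<^sub>v w"
  and vcong_sym: "u \<cong>\<^sub>v v \<Longrightarrow> v \<cong>\<^sub>v u" and vcong_refl: "u \<cong>\<^sub>v u"
  unfolding vcong_def using zcong_trans zcong_sym by blast+ simp

definition act :: "'n \<Rightarrow> ('n monom \<Rightarrow> 'r) \<Rightarrow> 'n monom \<Rightarrow> 'r" where
  "act k v t = (\<Sum>s\<in>\<O>. A k t s * v s)"

lemma act_cong: "v \<cong>\<^sub>v w \<Longrightarrow> act k v \<cong>\<^sub>v act k w"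
  by (auto simp: vcong_def act_def intro!: zcong_sum zcong_mult)

lemma act_commute: "act k (act l v) \<cong>\<^sub>v act l (act k v)"
  unfolding vcong_def
proof
  fix t assume t: "t \<in> \<O>"
  have *: "act k (act l v) t = (\<Sum>s\<in>\<O>. v s * (\<Sum>u\<in>\<O>. A k t u * A l u s))" for k l
    unfolding act_def sum_distrib_left by (subst sum.swap) (simp add: mult_ac)
  show "act k (act l v) t \<approx> act l (act k v) t"
    unfolding * by (rule zcong_sum, rule zcong_mult) (simp add: zcong_def A_commute t)
qed

definition unit_vec :: "'n monom \<Rightarrow> 'n monom \<Rightarrow> 'r" where
  "unit_vec s t = (if t = s then 1 else 0)"

lemma act_unit_vec: "s \<in> \<O> \<Longrightarrow> act k (unit_vec s) t = A k t s"
  by (simp add: act_def unit_vec_def if_distrib finite_O cong: if_cong)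

text \<open>
  A term acts as a product of matrices along any list of indeterminates whose product it is. By
  commutativity the order of the list does not matter modulo \<open>Z\<close>, so the action of a term is
  well defined up to congruence.
\<close>

definition term_of :: "'n list \<Rightarrow> 'n monom" where
  "term_of xs = sum_list (map indet xs)"

lemma term_of_simps: "term_of [] = 0" "term_of (x # xs) = indet x + term_of xs"
  "term_of (xs @ ys) = term_of xs + term_of ys"
  by (simp_all add: term_of_def)

lemma ex_term_of: "\<exists>xs. term_of xs = m"
proof (induction m rule: wf_induct_rule[OF wf_less])
  case (1 m)
  show ?case
  proof (cases "m = 0")
    case False
    then obtain k where "k \<in> keys m" by (metis keys_eq_empty all_not_in_conv)
    then obtain m' where m: "m = indet k + m'" by (rule indet_split)
    then obtain xs where "term_of xs = m'" using 1[of m'] less_indet_add by auto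
    then have "term_of (k # xs) = m" by (simp add: m term_of_simps)
    then show ?thesis ..
  qed (use term_of_simps(1) in blast)
qed

lemma keys_term_of: "keys (term_of xs) = set xs"
proof (induction xs)
  case (Cons x xs)
  have "keys (indet x + m) = insert x (keys m)" for m
    by (auto simp: in_keys_iff lookup_add indet_def lookup_single when_def split: if_splits)
  with Cons show ?case by (simp add: term_of_simps)
qed (simp add: term_of_simps)

definition path_vec :: "'n list \<Rightarrow> 'n monom \<Rightarrow> 'r" where
  "path_vec xs = foldr act xs (unit_vec 0)"

lemma path_vec_simps: "path_vec [] = unit_vec 0" "path_vec (x # xs) = act x (path_vec xs)"
  by (simp_all add: path_vec_def)

lemma path_vec_move: "path_vec (xs @ k # ys) \<cong>\<^sub>v path_vec (k # xs @ ys)"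
proof (induction xs)
  case (Cons x xs)
  have "path_vec ((x # xs) @ k # ys) \<cong>\<^sub>v act x (path_vec (k # xs @ ys))"
    using act_cong[OF Cons] by (simp add: path_vec_simps)
  also have "\<dots> \<cong>\<^sub>v path_vec (k # (x # xs) @ ys)"
    using act_commute by (simp add: path_vec_simps)
  finally show ?case .
qed (simp add: vcong_refl)

lemma path_vec_cong: "term_of xs = term_of ys \<Longrightarrow> path_vec xs \<cong>\<^sub>v path_vec ys"
proof (induction xs arbitrary: ys)
  case Nil
  then have "set ys = {}" by (metis keys_term_of list.set(1))
  then show ?case by (simp add: vcong_refl)
next
  case (Cons x xs)
  then have "x \<in> set ys" by (metis keys_term_of list.set_intros(1))
  then obtain as bs where ys: "ys = as @ x # bs" by (meson split_list)
  then have "indet x + term_of xs = indet x + term_of (as @ bs)"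
    using Cons.prems by (simp add: term_of_simps add.left_commute)
  then have "term_of xs = term_of (as @ bs)" by (rule add_left_imp_eq)
  then have "path_vec (x # xs) \<cong>\<^sub>v path_vec (x # as @ bs)"
    using act_cong[OF Cons.IH] by (simp add: path_vec_simps)
  also have "\<dots> \<cong>\<^sub>v path_vec ys"
    unfolding ys by (rule vcong_sym[OF path_vec_move])
  finally show ?case .
qed

text \<open>
  As \<open>\<O>\<close> is closed under divisors, all partial products of the list lie in \<open>\<O>\<close>, where the matrices
  just multiply by the indeterminate.
\<close>

lemma path_vec_O: "term_of xs \<in> \<O> \<Longrightarrow> path_vec xs \<cong>\<^sub>v unit_vec (term_of xs)"
proof (induction xs)
  case (Cons x xs)
  let ?s = "term_of xs"
  have s: "?s \<in> \<O>"
    using Cons.prems by (rule dvd_closed) (simp add: tdvd_iff term_of_simps lookup_add)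
  then have "path_vec (x # xs) \<cong>\<^sub>v act x (unit_vec ?s)"
    using act_cong[OF Cons.IH] by (simp add: path_vec_simps)
  also have "\<dots> \<cong>\<^sub>v unit_vec (term_of (x # xs))"
    using Cons.prems A_inside[OF s, of x]
    by (auto simp: vcong_def act_unit_vec[OF s] unit_vec_def term_of_simps)
  finally show ?case .
qed (simp add: path_vec_simps term_of_simps vcong_refl)

definition term_vec :: "'n monom \<Rightarrow> 'n monom \<Rightarrow> 'r" where
  "term_vec m = path_vec (SOME xs. term_of xs = m)"

lemma term_vec_path_vec: "term_vec (term_of xs) \<cong>\<^sub>v path_vec xs"
  unfolding term_vec_def by (rule path_vec_cong, rule someI_ex, rule ex_term_of)

lemma term_vec_indet_add: "term_vec (indet k + m) \<cong>\<^sub>v act k (term_vec m)"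
proof -
  let ?xs = "SOME xs. term_of xs = m"
  have "term_of ?xs = m" by (rule someI_ex, rule ex_term_of)
  then show ?thesis
    using term_vec_path_vec[of "k # ?xs"] by (simp add: term_of_simps path_vec_simps term_vec_def)
qed

lemma term_vec_O: 
  assumes "s \<in> \<O>"
  shows "term_vec s \<cong>\<^sub>v unit_vec s"
proof -
  obtain xs where "term_of xs = s" using ex_term_of by blast
  then show ?thesis using vcong_trans[OF term_vec_path_vec path_vec_O, of xs] assms by simp
qed

text \<open>
  The vector \<open>poly_vec f\<close> is the image of the unit vector of the term \<open>1\<close> under the action of \<open>f\<close>,
  and \<open>vanishing\<close> is the annihilator of that vector modulo \<open>Z\<close>.
\<close>

definition poly_vec :: "('n, 'r) mpoly \<Rightarrow> 'n monom \<Rightarrow> 'r" where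
  "poly_vec f t = (\<Sum>m\<in>keys f. lookup f m * term_vec m t)"

definition vanishing :: "('n, 'r) mpoly set" where
  "vanishing = {f. \<forall>t\<in>\<O>. poly_vec f t \<in> Z}"

lemma poly_vec_single: "poly_vec (single m c) t = c * term_vec m t"
  by (simp add: poly_vec_def)

lemma additive_poly_vec: "additive (\<lambda>f. poly_vec f t)"
proof
  fix f g :: "('n, 'r) mpoly"
  have *: "poly_vec h t = (\<Sum>m\<in>keys f \<union> keys g. lookup h m * term_vec m t)"
    if "keys h \<subseteq> keys f \<union> keys g" for h
    unfolding poly_vec_def using that by (intro sum.mono_neutral_left) (auto simp: in_keys_iff)
  show "poly_vec (f + g) t = poly_vec f t + poly_vec g t"
    by (simp add: * keys_add lookup_add distrib_right sum.distrib)
qed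

lemma vanishing_add: "f \<in> vanishing \<Longrightarrow> g \<in> vanishing \<Longrightarrow> f + g \<in> vanishing"
  using is_submodule_add[OF ideal_Z] by (simp add: vanishing_def additive.add[OF additive_poly_vec])

lemma vanishing_sum: "(\<And>x. x \<in> S \<Longrightarrow> F x \<in> vanishing) \<Longrightarrow> sum F S \<in> vanishing"
  by (auto simp: vanishing_def additive.sum[OF additive_poly_vec] intro!: is_submodule_sum[OF ideal_Z])

lemma poly_vec_single_mult:
  "poly_vec (single m c * f) t = (\<Sum>n\<in>keys f. c * lookup f n * term_vec (m + n) t)"
proof -
  have "single m c * f = (\<Sum>n\<in>keys f. single (m + n) (c * lookup f n))"
    by (subst poly_expand[of f]) (simp only: sum_distrib_left mult_single)
  then show ?thesis by (simp add: additive.sum[OF additive_poly_vec] poly_vec_single)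
qed

lemma vanishing_const_mult: "f \<in> vanishing \<Longrightarrow> single 0 c * f \<in> vanishing"
  using is_submodule_mult[OF ideal_Z, of c]
  by (simp add: vanishing_def poly_vec_single_mult)
     (simp add: poly_vec_def mult.assoc flip: sum_distrib_left)

lemma vanishing_indet_mult:
  assumes "f \<in> vanishing"
  shows "single (indet k) 1 * f \<in> vanishing"
  unfolding vanishing_def
proof clarify
  fix t assume t: "t \<in> \<O>"
  have "poly_vec (single (indet k) 1 * f) t = (\<Sum>n\<in>keys f. lookup f n * term_vec (indet k + n) t)"
    by (simp add: poly_vec_single_mult)
  also have "\<dots> \<approx> (\<Sum>n\<in>keys f. lookup f n * act k (term_vec n) t)"
    using term_vec_indet_add t by (intro zcong_sum zcong_mult) (auto simp: vcong_def)
  also have "(\<Sum>n\<in>keys f. lookup f n * act k (term_vec n) t) = (\<Sum>s\<in>\<O>. A k t s * poly_vec f s)"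
    unfolding act_def poly_vec_def sum_distrib_left by (subst sum.swap) (simp add: mult_ac)
  finally show "poly_vec (single (indet k) 1 * f) t \<in> Z"
    by (rule zcong_mem)
      (use assms in \<open>auto simp: vanishing_def intro!: is_submodule_sum[OF ideal_Z] is_submodule_mult[OF ideal_Z]\<close>)
qed

lemma vanishing_term_mult:
  assumes "f \<in> vanishing"
  shows "single (term_of xs) 1 * f \<in> vanishing"
proof (induction xs)
  case (Cons x xs)
  have "single (term_of (x # xs)) (1::'r) = single (indet x) 1 * single (term_of xs) 1"
    by (simp add: mult_single term_of_simps)
  then show ?case using vanishing_indet_mult[OF Cons] by (simp add: mult.assoc)
qed (simp add: assms term_of_simps)

lemma is_submodule_vanishing: "is_submodule UNIV vanishing"
  unfolding is_submodule_def
proof safe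
  show "0 \<in> vanishing"
    by (simp add: vanishing_def poly_vec_def is_submodule_zero[OF ideal_Z])
  fix p f assume f: "f \<in> vanishing"
  have "p * f = (\<Sum>m\<in>keys p. single 0 (lookup p m) * (single m 1 * f))"
    by (subst poly_expand[of p]) (simp add: sum_distrib_right mult.assoc[symmetric] mult_single)
  also have "\<dots> \<in> vanishing"
  proof (intro vanishing_sum vanishing_const_mult)
    fix m
    obtain xs where "term_of xs = m" using ex_term_of by blast
    then show "single m 1 * f \<in> vanishing" using vanishing_term_mult[OF f, of xs] by simp
  qed
  finally show "p * f \<in> vanishing" .
qed (rule vanishing_add)

lemma poly_vec_O:
  assumes "keys f \<subseteq> \<O>" "t \<in> \<O>"
  shows "poly_vec f t \<approx> lookup f t"
proof -
  have "poly_vec f t \<approx> (\<Sum>m\<in>keys f. lookup f m * unit_vec m t)"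
    unfolding poly_vec_def using assms term_vec_O
    by (intro zcong_sum zcong_mult) (auto simp: vcong_def)
  also have "(\<Sum>m\<in>keys f. lookup f m * unit_vec m t) = lookup f t"
    by (simp add: unit_vec_def if_distrib in_keys_iff cong: if_cong)
  finally show ?thesis .
qed

text \<open>
  On polynomials supported on \<open>\<O>\<close> the action returns the coefficients.
\<close>

lemma vanishing_coeff:
  assumes "f \<in> vanishing" "keys f \<subseteq> \<O>"
  shows "lookup f t \<in> Z"
proof (cases "t \<in> \<O>")
  case True
  have "lookup f t \<approx> poly_vec f t" by (rule zcong_sym[OF poly_vec_O[OF assms(2) True]])
  then show ?thesis by (rule zcong_mem) (use assms(1) True in \<open>simp add: vanishing_def\<close>)
next
  case False
  then have "lookup f t = 0" using assms(2) by (auto simp: in_keys_iff)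
  then show ?thesis by (simp add: is_submodule_zero[OF ideal_Z])
qed

text \<open>
  The column of the matrix of \<open>x\<^sub>k\<close> at \<open>s\<close> is the image of the term \<open>x\<^sub>k s\<close>, so a rewriting rule for
  this term acts as zero once its tail agrees with the column.
\<close>

lemma border_vanishing:
  assumes s: "s \<in> \<O>" and f: "keys f \<subseteq> \<O>" "\<And>t. t \<in> \<O> \<Longrightarrow> A k t s \<approx> lookup f t"
  shows "single (indet k + s) 1 - f \<in> vanishing"
  unfolding vanishing_def
proof clarify
  fix t assume t: "t \<in> \<O>"
  have "term_vec (indet k + s) \<cong>\<^sub>v act k (unit_vec s)"
    using term_vec_indet_add act_cong[OF term_vec_O[OF s]] by (rule vcong_trans)
  then have "term_vec (indet k + s) t \<approx> A k t s"
    using t by (simp add: vcong_def act_unit_vec[OF s])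
  also have "A k t s \<approx> poly_vec f t"
    using f(2)[OF t] zcong_sym[OF poly_vec_O[OF f(1) t]] by (rule zcong_trans)
  finally show "poly_vec (single (indet k + s) 1 - f) t \<in> Z"
    by (simp add: additive.diff[OF additive_poly_vec] poly_vec_single zcong_def)
qed

text \<open>
  From a vector supported on terms up to \<open>m\<close>, multiplication by \<open>x\<^sub>k\<close> leads only to terms up to
  \<open>x\<^sub>k m\<close>, since \<open>s \<preceq> m\<close> implies \<open>x\<^sub>k s \<preceq> x\<^sub>k m\<close>.
\<close>

lemma path_vec_triangular:
  assumes tri: "\<And>k s t. s \<in> \<O> \<Longrightarrow> t \<in> \<O> \<Longrightarrow> \<not> t \<preceq> indet k + s \<Longrightarrow> A k t s \<in> Z"
  shows "t \<in> \<O> \<Longrightarrow> \<not> t \<preceq> term_of xs \<Longrightarrow> path_vec xs t \<in> Z"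
proof (induction xs arbitrary: t)
  case Nil
  then show ?case
    using le_refl is_submodule_zero[OF ideal_Z]
    by (auto simp: path_vec_simps unit_vec_def term_of_simps)
next
  case (Cons x xs)
  show ?case unfolding path_vec_simps act_def
  proof (rule is_submodule_sum[OF ideal_Z])
    fix s assume s: "s \<in> \<O>"
    show "A x t s * path_vec xs s \<in> Z"
    proof (cases "s \<preceq> term_of xs")
      case True
      then have "\<not> t \<preceq> indet x + s"
        using Cons.prems(2) add_le_left le_trans by (auto simp: term_of_simps)
      then have "path_vec xs s * A x t s \<in> Z"
        using tri s Cons.prems(1) by (intro is_submodule_mult[OF ideal_Z]) auto
      then show ?thesis by (simp add: mult.commute)
    next
      case False
      then show ?thesis using Cons.IH s by (intro is_submodule_mult[OF ideal_Z]) auto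
    qed
  qed
qed

text \<open>
  In the triangular case the smaller terms of \<open>f\<close> contribute nothing at the leading term \<open>t\<close>, which
  therefore contributes its coefficient alone.
\<close>

lemma vanishing_leading_coeff:
  assumes tri: "\<And>k s t. s \<in> \<O> \<Longrightarrow> t \<in> \<O> \<Longrightarrow> \<not> t \<preceq> indet k + s \<Longrightarrow> A k t s \<in> Z"
    and f: "f \<in> vanishing" and t: "t \<in> \<O>" "t \<in> keys f" "\<And>m. m \<in> keys f \<Longrightarrow> m \<preceq> t"
  shows "lookup f t \<in> Z"
proof -
  have "lookup f m * term_vec m t \<approx> lookup f m * unit_vec m t" if m: "m \<in> keys f" for m
  proof (cases "m = t")
    case True
    then show ?thesis using term_vec_O t(1) by (auto simp: vcong_def intro: zcong_mult)
  next
    case False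
    obtain xs where xs: "term_of xs = m" using ex_term_of by blast
    have "\<not> t \<preceq> m" using False t(3)[OF m] le_antisym by blast
    then have "path_vec xs t \<approx> 0"
      using path_vec_triangular[OF tri, of t xs] t(1) xs by (simp add: zcong_0)
    moreover have "term_vec m t \<approx> path_vec xs t"
      using term_vec_path_vec[of xs] t(1) xs by (simp add: vcong_def)
    ultimately have "term_vec m t \<approx> 0" using zcong_trans by blast
    then show ?thesis using False zcong_mult[of _ 0] by (simp add: unit_vec_def)
  qed
  then have "poly_vec f t \<approx> (\<Sum>m\<in>keys f. lookup f m * unit_vec m t)"
    unfolding poly_vec_def by (rule zcong_sum)
  also have "\<dots> = lookup f t"
    using t(2) by (simp add: unit_vec_def if_distrib cong: if_cong)
  finally have "lookup f t \<approx> poly_vec f t" by (rule zcong_sym)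
  then show ?thesis by (rule zcong_mem) (use f t(1) in \<open>simp add: vanishing_def\<close>)
qed

end

section \<open>Combinations of finitely many generators\<close>

definition combinations :: "'r::comm_ring_1 set \<Rightarrow> 'b set \<Rightarrow> ('b \<Rightarrow> 'r) \<Rightarrow> 'r set" where
  "combinations R B g = {\<Sum>b\<in>B. f b * g b | f. \<forall>b\<in>B. f b \<in> R}"

lemma combinations_generator:
  assumes "is_subring R" "finite B" "b \<in> B"
  shows "g b \<in> combinations R B g"
proof -
  have "g b = (\<Sum>b'\<in>B. (if b' = b then 1 else 0) * g b')"
    using assms(2,3) by (simp add: if_distrib[of "\<lambda>x. x * _"] cong: if_cong)
  then show ?thesis unfolding combinations_def
    by (intro CollectI exI[of _ "\<lambda>b'. if b' = b then 1 else 0"])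
      (simp add: is_subring_one is_subring_zero assms(1))
qed

lemma is_submodule_combinations:
  assumes R: "is_subring R"
  shows "is_submodule R (combinations R B g)"
  unfolding is_submodule_def
proof safe
  show "0 \<in> combinations R B g" unfolding combinations_def
    by (intro CollectI exI[of _ "\<lambda>_. 0"]) (simp add: is_subring_zero[OF R])
next
  fix x y assume "x \<in> combinations R B g" "y \<in> combinations R B g"
  then obtain f f' where f: "x = (\<Sum>b\<in>B. f b * g b)" "\<forall>b\<in>B. f b \<in> R"
    "y = (\<Sum>b\<in>B. f' b * g b)" "\<forall>b\<in>B. f' b \<in> R" unfolding combinations_def by blast
  then show "x + y \<in> combinations R B g" unfolding combinations_def
    by (intro CollectI exI[of _ "\<lambda>b. f b + f' b"])
      (simp add: is_subring_add[OF R] distrib_right sum.distrib)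
next
  fix r x assume "r \<in> R" "x \<in> combinations R B g"
  moreover from this obtain f where "x = (\<Sum>b\<in>B. f b * g b)" "\<forall>b\<in>B. f b \<in> R"
    unfolding combinations_def by blast
  ultimately show "r * x \<in> combinations R B g" unfolding combinations_def
    by (intro CollectI exI[of _ "\<lambda>b. r * f b"])
      (simp add: is_subring_mult[OF R] sum_distrib_left mult.assoc)
qed

lemma combinations_least:
  assumes "is_submodule R M" "\<And>b. b \<in> B \<Longrightarrow> g b \<in> M"
  shows "combinations R B g \<subseteq> M"
  unfolding combinations_def
  by (auto intro!: is_submodule_sum[OF assms(1)] is_submodule_mult[OF assms(1)] assms(2))

lemma polys_in_UNIV: "polys_in UNIV = UNIV"
  by (simp add: polys_in_def)

lemma coeffs_in_UNIV: "coeffs_in UNIV = UNIV"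
  by (simp add: coeffs_in_def)

lemma genideal_eq_combinations:
  assumes "finite B"
  shows "Idl\<^bsub>poly_ring UNIV\<^esub> (g ` B) = combinations UNIV B g"
proof
  show "Idl\<^bsub>poly_ring UNIV\<^esub> (g ` B) \<subseteq> combinations UNIV B g"
    using is_submodule_combinations[OF is_subring_UNIV] combinations_generator[OF is_subring_UNIV assms]
    by (intro genideal_least) (auto simp: polys_in_UNIV)
  have "ideal (Idl\<^bsub>poly_ring UNIV\<^esub> (g ` B)) (poly_ring UNIV)"
    "g ` B \<subseteq> Idl\<^bsub>poly_ring UNIV\<^esub> (g ` B)"
    by (intro ideal_genideal genideal_superset; simp add: polys_in_UNIV)+
  then show "combinations UNIV B g \<subseteq> Idl\<^bsub>poly_ring UNIV\<^esub> (g ` B)"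
    by (intro combinations_least) (auto simp: ideal_poly_ring_iff polys_in_UNIV)
qed

section \<open>Rewriting the border terms by the generic generators\<close>

context order_ideal_with_order
begin

abbreviation coeff_ring :: "('n cvar, 'k::field) mpoly set" where
  "coeff_ring \<equiv> polys_in (S_corner_vars \<O> \<sigma>)"

lemma S_corner_vars_iff: "(t, b) \<in> S_corner_vars \<O> \<sigma> \<longleftrightarrow> t \<in> \<O> \<and> b \<in> corners \<O> \<and> t \<prec> b"
  using corners_subset_border by (auto simp: S_corner_vars_def S_vars_def cvars_def)

lemma S_corner_vars_subset: "S_corner_vars \<O> \<sigma> \<subseteq> cvars \<O>"
  by (auto simp: S_corner_vars_def S_vars_def)

definition gstar_tail :: "'n monom \<Rightarrow> ('n, ('n cvar, 'k::field) mpoly) mpoly" where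
  "gstar_tail b = (\<Sum>t\<in>{t\<in>\<O>. t \<prec> b}. single t (cpoly t b))"

lemma gstar_eq: "gstar \<O> \<sigma> b = single b 1 - gstar_tail b"
  by (simp add: gstar_def gstar_tail_def)

lemma lookup_gstar_tail: "lookup (gstar_tail b) t = (if t \<in> \<O> \<and> t \<prec> b then cpoly t b else 0)"
  using finite_O by (simp add: gstar_tail_def lookup_sum lookup_single when_def)

lemma keys_gstar_tail: "keys (gstar_tail b) \<subseteq> {t\<in>\<O>. t \<prec> b}"
  by (auto simp: in_keys_iff lookup_gstar_tail split: if_splits)

lemma cpoly_in_polys_in: "(t, b) \<in> V \<Longrightarrow> cpoly t b \<in> polys_in V"
  by (simp add: cpoly_def polys_in_def indet_def)

lemma gstar_tail_coeffs: "b \<in> corners \<O> \<Longrightarrow> gstar_tail b \<in> coeffs_in coeff_ring"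
  by (auto simp: coeffs_in_def lookup_gstar_tail S_corner_vars_iff cpoly_in_polys_in
      is_subring_zero[OF is_subring_polys_in])

definition gstar_module :: "('n, ('n cvar, 'k::field) mpoly) mpoly set" where
  "gstar_module = combinations (coeffs_in coeff_ring) (corners \<O>) (gstar \<O> \<sigma>)"

lemma is_submodule_gstar_module: "is_submodule (coeffs_in coeff_ring) gstar_module"
  unfolding gstar_module_def
  by (intro is_submodule_combinations is_subring_coeffs_in is_subring_polys_in)

lemma gstar_in_gstar_module: "b \<in> corners \<O> \<Longrightarrow> gstar \<O> \<sigma> b \<in> gstar_module"
  unfolding gstar_module_def
  by (intro combinations_generator is_subring_coeffs_in is_subring_polys_in finite_corners)

lemma ex_reduct:
  "\<exists>f. f \<in> coeffs_in coeff_ring \<and> keys f \<subseteq> {t\<in>\<O>. t \<preceq> m} \<and> single m 1 - f \<in> gstar_module"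
proof -
  have "\<exists>f\<in>coeffs_in coeff_ring. (\<forall>s\<in>keys f. s \<prec> b) \<and> single b 1 - f \<in> gstar_module"
    if "b \<in> corners \<O>" for b
    using that keys_gstar_tail[of b] gstar_tail_coeffs gstar_in_gstar_module[OF that]
    by (intro bexI[of _ "gstar_tail b"]) (auto simp: gstar_eq)
  then show ?thesis
    using normal_form_term[OF is_subring_polys_in is_submodule_gstar_module
        corner_step[OF is_subring_polys_in is_submodule_gstar_module]] by blast
qed

text \<open>
  Terms of \<open>\<O>\<close> are their own normal forms, which gives the reduction matrices below their unit columns.
  The prescribed values at corners make the homomorphism \<open>eliminate\<close> fix the indeterminates of corners.
\<close>

definition reduct :: "'n monom \<Rightarrow> ('n, ('n cvar, 'k::field) mpoly) mpoly" where
  "reduct m = (if m \<in> \<O> then single m 1 else if m \<in> corners \<O> then gstar_tail m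
     else SOME f. f \<in> coeffs_in coeff_ring \<and> keys f \<subseteq> {t\<in>\<O>. t \<preceq> m} \<and> single m 1 - f \<in> gstar_module)"

lemma reduct:
  fixes m :: "'n monom"
  defines "f \<equiv> (reduct m :: ('n, ('n cvar, 'k::field) mpoly) mpoly)"
  shows reduct_coeffs: "f \<in> coeffs_in coeff_ring"
    and reduct_keys: "keys f \<subseteq> {t\<in>\<O>. t \<preceq> m}"
    and reduct_cong: "single m 1 - f \<in> gstar_module"
  unfolding atomize_conj f_def
proof -
  let ?P = "\<lambda>f :: ('n, ('n cvar, 'k) mpoly) mpoly. f \<in> coeffs_in coeff_ring \<and> keys f \<subseteq> {t\<in>\<O>. t \<preceq> m} \<and> single m 1 - f \<in> gstar_module"
  show "?P (reduct m)"
  proof -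
    consider "m \<in> \<O>" | "m \<in> corners \<O>" "m \<notin> \<O>" | "m \<notin> \<O>" "m \<notin> corners \<O>" by blast
    then show ?thesis
    proof cases
      case 1
      then show ?thesis
        using single_in_coeffs_in[OF is_subring_polys_in is_subring_one[OF is_subring_polys_in]]
        by (simp add: reduct_def le_refl is_submodule_zero[OF is_submodule_gstar_module])
    next
      case 2
      then show ?thesis
        using keys_gstar_tail[of m] gstar_tail_coeffs gstar_in_gstar_module[of m] less_imp_le
        by (auto simp: reduct_def gstar_eq)
    next
      case 3
      then have *: "reduct m = (SOME f. ?P f)" by (simp add: reduct_def)
      show ?thesis unfolding * by (rule someI_ex[OF ex_reduct])
    qed
  qed
qed

lemma reduct_O: "m \<in> \<O> \<Longrightarrow> reduct m = single m 1"
  by (simp add: reduct_def)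

lemma reduct_corner: "b \<in> corners \<O> \<Longrightarrow> reduct b = gstar_tail b"
  using corner_not_in_O by (simp add: reduct_def)

lemma lookup_reduct_in: "lookup (reduct m) t \<in> coeff_ring"
  using reduct_coeffs by (auto simp: coeffs_in_def)

lemma lookup_reduct_not_le: "\<not> t \<preceq> m \<Longrightarrow> lookup (reduct m) t = 0"
  using reduct_keys[of m] by (auto simp: in_keys_iff)

lemma reduct_expand: "reduct m = (\<Sum>t\<in>\<O>. single t (lookup (reduct m) t))"
  using reduct_keys[of m] by (intro poly_expand_superset finite_O) auto

text \<open>
  The matrix of multiplication by \<open>x\<^sub>k\<close> followed by reduction; \<open>reduct2 k l s\<close> is the result of
  multiplying \<open>s\<close> by \<open>x\<^sub>l\<close>, reducing, multiplying by \<open>x\<^sub>k\<close> and reducing again.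
\<close>

definition reduct_mat :: "'n \<Rightarrow> 'n monom \<Rightarrow> 'n monom \<Rightarrow> ('n cvar, 'k::field) mpoly" where
  "reduct_mat k t s = lookup (reduct (indet k + s)) t"

definition reduct2 :: "'n \<Rightarrow> 'n \<Rightarrow> 'n monom \<Rightarrow> ('n, ('n cvar, 'k::field) mpoly) mpoly" where
  "reduct2 k l s = (\<Sum>u\<in>\<O>. single 0 (reduct_mat l u s) * reduct (indet k + u))"

lemma lookup_reduct2: "lookup (reduct2 k l s) t = (\<Sum>u\<in>\<O>. reduct_mat k t u * reduct_mat l u s)"
  by (simp add: reduct2_def lookup_sum lookup_const_mult reduct_mat_def) (simp add: mult.commute)

lemma reduct2_cong: "single (indet k + (indet l + s)) 1 - reduct2 k l s
    \<in> (gstar_module :: ('n, ('n cvar, 'k::field) mpoly) mpoly set)"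
proof -
  note G = is_submodule_gstar_module
  let ?k = "single (indet k) 1 :: ('n, ('n cvar, 'k) mpoly) mpoly"
  let ?m = "indet l + s"
  have "?k * reduct ?m = (\<Sum>u\<in>\<O>. single 0 (reduct_mat l u s) * single (indet k + u) 1)"
    by (subst reduct_expand[of ?m]) (simp add: sum_distrib_left mult_single reduct_mat_def)
  then have *: "?k * reduct ?m - reduct2 k l s =
      (\<Sum>u\<in>\<O>. single 0 (reduct_mat l u s) * (single (indet k + u) 1 - reduct (indet k + u)))"
    by (simp add: reduct2_def right_diff_distrib sum_subtractf)
  have "?k * reduct ?m - reduct2 k l s \<in> gstar_module" unfolding *
    using reduct_cong lookup_reduct_in
    by (intro is_submodule_sum[OF G] is_submodule_mult[OF G] single_in_coeffs_in is_subring_polys_in)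
      (auto simp: reduct_mat_def)
  moreover have "?k * (single ?m 1 - reduct ?m) \<in> gstar_module"
    using reduct_cong
    by (intro is_submodule_mult[OF G] single_in_coeffs_in is_subring_polys_in is_subring_one)
  ultimately have "?k * (single ?m 1 - reduct ?m) + (?k * reduct ?m - reduct2 k l s) \<in> gstar_module"
    by (intro is_submodule_add[OF G])
  then show ?thesis by (simp add: right_diff_distrib mult_single)
qed

text \<open>
  Both reductions of the term \<open>x\<^sub>k x\<^sub>l s\<close> are congruent to it, so their difference is a consequence
  of the \<open>g\<^sub>b\<^sup>*\<close>. It is supported on \<open>\<O>\<close>, with the commutator of the reduction matrices as coefficients.
\<close>

definition syzygy :: "'n \<Rightarrow> 'n \<Rightarrow> 'n monom \<Rightarrow> ('n, ('n cvar, 'k::field) mpoly) mpoly" where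
  "syzygy k l s = reduct2 k l s - reduct2 l k s"

lemma syzygy_in: "syzygy k l s \<in> gstar_module"
proof -
  have "syzygy k l s = (single (indet l + (indet k + s)) 1 - reduct2 l k s) -
      (single (indet k + (indet l + s)) 1 - reduct2 k l s)"
    by (simp add: syzygy_def add.left_commute)
  also have "\<dots> \<in> gstar_module"
    by (intro is_submodule_diff[OF is_submodule_gstar_module] reduct2_cong
        is_subring_coeffs_in is_subring_polys_in)
  finally show ?thesis .
qed

lemma reduct_mat_outside: "t \<notin> \<O> \<Longrightarrow> reduct_mat k t s = 0"
  using reduct_keys[of "indet k + s"] by (auto simp: reduct_mat_def in_keys_iff)

lemma syzygy_keys: "keys (syzygy k l s) \<subseteq> \<O>"
proof
  fix t assume "t \<in> keys (syzygy k l s)"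
  then show "t \<in> \<O>"
    by (rule contrapos_pp) (simp add: syzygy_def in_keys_iff lookup_minus lookup_reduct2 reduct_mat_outside)
qed

lemma lookup_syzygy_in: "lookup (syzygy k l s) t \<in> coeff_ring"
  unfolding syzygy_def lookup_minus lookup_reduct2 reduct_mat_def
  by (intro is_subring_diff[OF is_subring_polys_in] is_subring_sum[OF is_subring_polys_in]
      is_subring_mult[OF is_subring_polys_in] lookup_reduct_in)

text \<open>
  Modulo \<open>L + I(B)\<close> every \<open>c\<^sub>t\<^sub>b\<close> with \<open>b\<close> in the border is a polynomial in the indeterminates of the
  corners, namely the coefficient of \<open>t\<close> in \<open>reduct b\<close>. This homomorphism makes the replacement.
\<close>

definition eliminate :: "('n cvar, 'k::field) mpoly \<Rightarrow> ('n cvar, 'k) mpoly" where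
  "eliminate = subst_poly const (\<lambda>(t, b). lookup (reduct b) t)"

lemma unital_hom_eliminate: "unital_hom eliminate"
  unfolding eliminate_def by (rule unital_hom_subst_poly[OF unital_hom_const])

lemma eliminate_cpoly: "eliminate (cpoly t b) = lookup (reduct b) t"
  by (simp add: eliminate_def cpoly_def subst_poly_indet[OF unital_hom_const])

lemma eliminate_gen_mult_matrix:
  "s \<in> \<O> \<Longrightarrow> eliminate (gen_mult_matrix \<O> k t s) = reduct_mat k t s"
  by (auto simp: gen_mult_matrix_def reduct_mat_def reduct_O eliminate_cpoly lookup_single when_def
      unital_hom_props[OF unital_hom_eliminate])

lemma eliminate_commutator_entry:
  "s \<in> \<O> \<Longrightarrow> eliminate (commutator_entry \<O> k l t s) = lookup (syzygy k l s) t"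
  by (simp add: commutator_entry_def syzygy_def lookup_minus lookup_reduct2
      unital_hom_props[OF unital_hom_eliminate] eliminate_gen_mult_matrix)

lemma eliminate_ident:
  assumes "f \<in> coeff_ring"
  shows "eliminate f = f"
  unfolding eliminate_def using assms
  by (rule subst_poly_ident)
    (auto simp: S_corner_vars_iff reduct_corner lookup_gstar_tail cpoly_def)

lemma eliminate_in: "eliminate f \<in> coeff_ring"
  unfolding eliminate_def
  by (rule subst_poly_const_in_polys_in[where V = UNIV])
    (auto simp: polys_in_UNIV lookup_reduct_in)

end

section \<open>The ideal of the Groebner basis scheme is generated by coefficients\<close>

context order_ideal_with_order
begin

lemma gen_mult_matrix_in:
  assumes "t \<in> \<O>" "s \<in> \<O>"
  shows "gen_mult_matrix \<O> k t s \<in> polys_in (cvars \<O>)"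
  using assms
  by (auto simp: gen_mult_matrix_def cvars_def border_def is_subring_zero[OF is_subring_polys_in]
      is_subring_one[OF is_subring_polys_in] intro!: cpoly_in_polys_in)

lemma commutator_entry_in:
  "t \<in> \<O> \<Longrightarrow> s \<in> \<O> \<Longrightarrow> commutator_entry \<O> k l t s \<in> polys_in (cvars \<O>)"
  unfolding commutator_entry_def
  by (intro is_subring_diff[OF is_subring_polys_in] is_subring_sum[OF is_subring_polys_in]
      is_subring_mult[OF is_subring_polys_in] gen_mult_matrix_in)

abbreviation scheme_sum :: "('n cvar, 'k::field) mpoly set" where
  "scheme_sum \<equiv> L_ideal \<O> \<sigma> <+>\<^bsub>poly_ring (cvars \<O>)\<^esub> border_scheme_ideal \<O>"

lemma L_generators: "{cpoly t b | t b. (t, b) \<in> cvars \<O> - S_vars \<O> \<sigma>} \<subseteq> polys_in (cvars \<O>)"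
  using cpoly_in_polys_in by blast

lemma border_generators:
  "{commutator_entry \<O> k l t s | k l t s. t \<in> \<O> \<and> s \<in> \<O>} \<subseteq> polys_in (cvars \<O>)"
  using commutator_entry_in by blast

lemma ideal_L: "ideal (L_ideal \<O> \<sigma>) (poly_ring (cvars \<O>))"
  unfolding L_ideal_def by (rule ideal_genideal[OF L_generators])

lemma ideal_border: "ideal (border_scheme_ideal \<O>) (poly_ring (cvars \<O>))"
  unfolding border_scheme_ideal_def by (rule ideal_genideal[OF border_generators])

lemma scheme_sum_iff: "f \<in> scheme_sum \<longleftrightarrow> (\<exists>x\<in>L_ideal \<O> \<sigma>. \<exists>y\<in>border_scheme_ideal \<O>. f = x + y)"
  by (auto simp: set_add_def set_mult_def poly_ring_def)

lemma is_submodule_scheme_sum: "is_submodule (polys_in (cvars \<O>)) scheme_sum"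
  using ring.add_ideals[OF ring_poly_ring ideal_L ideal_border] unfolding ideal_poly_ring_iff by blast+

lemma summands_subset:
  shows L_subset: "L_ideal \<O> \<sigma> \<subseteq> (scheme_sum :: ('n cvar, 'k::field) mpoly set)"
    and border_subset: "border_scheme_ideal \<O> \<subseteq> (scheme_sum :: ('n cvar, 'k) mpoly set)"
proof -
  have "0 \<in> (L_ideal \<O> \<sigma> :: ('n cvar, 'k) mpoly set)" "0 \<in> (border_scheme_ideal \<O> :: ('n cvar, 'k) mpoly set)"
    using ideal_L ideal_border by (auto simp: ideal_poly_ring_iff is_submodule_def)
  then show "L_ideal \<O> \<sigma> \<subseteq> (scheme_sum :: ('n cvar, 'k) mpoly set)"
    "border_scheme_ideal \<O> \<subseteq> (scheme_sum :: ('n cvar, 'k) mpoly set)"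
    by (force simp: scheme_sum_iff)+
qed

text \<open>
  The type of \<open>K[c]\<close> has more indeterminates than \<open>cvars \<O>\<close>. Sending these to \<open>0\<close> retracts it onto
  \<open>K[c]\<close>, and the preimage of \<open>L + I(B)\<close> is an ideal of the whole ambient ring with the same elements
  in \<open>K[c]\<close>.
\<close>

definition retract :: "('n cvar, 'k::field) mpoly \<Rightarrow> ('n cvar, 'k) mpoly" where
  "retract = subst_poly const (\<lambda>v. if v \<in> cvars \<O> then single (indet v) 1 else 0)"

lemma unital_hom_retract: "unital_hom retract"
  unfolding retract_def by (rule unital_hom_subst_poly[OF unital_hom_const])

lemma retract_ident: "f \<in> polys_in (cvars \<O>) \<Longrightarrow> retract f = f"
  unfolding retract_def by (rule subst_poly_ident) auto

lemma retract_in: "retract f \<in> polys_in (cvars \<O>)"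
  unfolding retract_def
  by (rule subst_poly_const_in_polys_in[where V = UNIV])
    (auto simp: polys_in_UNIV indet_def, simp_all add: polys_in_def)

definition scheme_congruence :: "('n cvar, 'k::field) mpoly set" where
  "scheme_congruence = {f. retract f \<in> scheme_sum}"

lemma scheme_congruence_iff: "f \<in> polys_in (cvars \<O>) \<Longrightarrow> f \<in> scheme_congruence \<longleftrightarrow> f \<in> scheme_sum"
  by (simp add: scheme_congruence_def retract_ident)

lemma commuting_gen_mult_matrix:
  "commuting_matrices \<sigma> \<O> (gen_mult_matrix \<O>) (scheme_congruence :: ('n cvar, 'k::field) mpoly set)"
proof
  note Q = is_submodule_scheme_sum
  show "is_submodule UNIV (scheme_congruence :: ('n cvar, 'k) mpoly set)"
    by (auto simp: is_submodule_def scheme_congruence_def unital_hom_props[OF unital_hom_retract]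
        intro: is_submodule_zero[OF Q] is_submodule_add[OF Q] is_submodule_mult[OF Q] retract_in)
next
  fix k l t s assume ts: "t \<in> \<O>" "s \<in> \<O>"
  have "commutator_entry \<O> k l t s \<in> (border_scheme_ideal \<O> :: ('n cvar, 'k) mpoly set)"
    using genideal_superset[OF border_generators] ts unfolding border_scheme_ideal_def by blast
  then have "commutator_entry \<O> k l t s \<in> (scheme_congruence :: ('n cvar, 'k) mpoly set)"
    using border_subset scheme_congruence_iff[OF commutator_entry_in[OF ts]] by blast
  then show "(\<Sum>u\<in>\<O>. gen_mult_matrix \<O> k t u * gen_mult_matrix \<O> l u s) -
      (\<Sum>u\<in>\<O>. gen_mult_matrix \<O> l t u * gen_mult_matrix \<O> k u s) \<in>
      (scheme_congruence :: ('n cvar, 'k) mpoly set)"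
    by (simp add: commutator_entry_def)
qed (simp_all add: gen_mult_matrix_def)

text \<open>
  The polynomials \<open>g\<^sub>b\<^sup>*\<close> act as zero modulo \<open>L + I(B)\<close>: the column at \<open>b\<close> of the generic matrix
  consists of the \<open>c\<^sub>t\<^sub>b\<close>, the tail of \<open>g\<^sub>b\<^sup>*\<close> contains those with \<open>t \<prec> b\<close>, and the remaining ones
  lie in \<open>L\<close>. So \<open>f\<close> acts as zero, whereas on \<open>\<O>\<close> the action returns the coefficients of \<open>f\<close>.
\<close>

lemma gstar_module_coeff:
  fixes f :: "('n, ('n cvar, 'k::field) mpoly) mpoly"
  assumes "f \<in> gstar_module" "keys f \<subseteq> \<O>" "lookup f t \<in> coeff_ring"
  shows "lookup f t \<in> groebner_scheme_ideal \<O> \<sigma>"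
proof -
  interpret cm: commuting_matrices \<sigma> \<O> "gen_mult_matrix \<O>"
    "scheme_congruence :: ('n cvar, 'k) mpoly set" by (rule commuting_gen_mult_matrix)
  have "gstar \<O> \<sigma> b \<in> cm.vanishing" if b: "b \<in> corners \<O>" for b
  proof -
    obtain k s where s: "s \<in> \<O>" "b = indet k + s" using b by (rule corner_border)
    show ?thesis unfolding gstar_eq s(2)
    proof (rule cm.border_vanishing[OF s(1)], unfold s(2)[symmetric])
      show "keys (gstar_tail b) \<subseteq> \<O>" using keys_gstar_tail by blast
      fix t assume t: "t \<in> \<O>"
      have A: "gen_mult_matrix \<O> k t s = (cpoly t b :: ('n cvar, 'k) mpoly)"
        using s(2) corner_not_in_O[OF b] by (simp add: gen_mult_matrix_def)
      have v: "(t, b) \<in> cvars \<O>" using t b corners_subset_border by (auto simp: cvars_def)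
      show "cm.zcong (gen_mult_matrix \<O> k t s) (lookup (gstar_tail b) t)"
      proof (cases "t \<prec> b")
        case False
        then have "cpoly t b \<in> (L_ideal \<O> \<sigma> :: ('n cvar, 'k) mpoly set)"
          using v genideal_superset[OF L_generators] unfolding L_ideal_def by (auto simp: S_vars_def)
        then show ?thesis using False L_subset scheme_congruence_iff[OF cpoly_in_polys_in[OF v]]
          by (auto simp: A lookup_gstar_tail cm.zcong_0)
      qed (simp add: A t lookup_gstar_tail)
    qed
  qed
  then have "combinations UNIV (corners \<O>) (gstar \<O> \<sigma>) \<subseteq> cm.vanishing"
    by (intro combinations_least cm.is_submodule_vanishing)
  moreover have "f \<in> combinations UNIV (corners \<O>) (gstar \<O> \<sigma>)"
    using assms(1) by (auto simp: gstar_module_def combinations_def)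
  ultimately have "lookup f t \<in> scheme_congruence" using cm.vanishing_coeff assms(2) by blast
  moreover have "lookup f t \<in> polys_in (cvars \<O>)"
    using assms(3) S_corner_vars_subset unfolding polys_in_def by blast
  ultimately show ?thesis
    using assms(3) by (simp add: scheme_congruence_iff groebner_scheme_ideal_def)
qed

lemma ideal_groebner_scheme_ideal:
  "ideal (groebner_scheme_ideal \<O> \<sigma>) (poly_ring (S_corner_vars \<O> \<sigma>))"
proof -
  have "coeff_ring \<subseteq> (polys_in (cvars \<O>) :: ('n cvar, 'a) mpoly set)"
    using S_corner_vars_subset unfolding polys_in_def by blast
  then show ?thesis
    using is_submodule_scheme_sum is_subring_closed[OF is_subring_polys_in[of "S_corner_vars \<O> \<sigma>"]]
    unfolding ideal_poly_ring_iff groebner_scheme_ideal_def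
    by (auto simp: is_submodule_def)
qed

text \<open>
  An element of \<open>J\<close> is fixed by \<open>eliminate\<close>, which maps \<open>L + I(B)\<close> into the ideal generated by the
  coefficients of the syzygies. The other inclusion is an instance of \<open>gstar_module_coeff\<close>.
\<close>

lemma groebner_scheme_ideal_eq:
  "groebner_scheme_ideal \<O> \<sigma> =
     (Idl\<^bsub>poly_ring (S_corner_vars \<O> \<sigma>)\<^esub> {lookup (syzygy k l s) t | k l s t. s \<in> \<O> \<and> t \<in> \<O>}
       :: ('n cvar, 'k::field) mpoly set)"  (is "?J = Idl\<^bsub>?P\<^esub> ?S")
proof
  have S: "?S \<subseteq> coeff_ring" using lookup_syzygy_in by blast
  have I: "is_submodule coeff_ring (Idl\<^bsub>?P\<^esub> ?S)"
    using ideal_genideal[OF S] by (simp add: ideal_poly_ring_iff)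
  \<comment> \<open>The elements of \<open>K[c]\<close> that \<open>eliminate\<close> sends into the ideal of the coefficients form an ideal, so
    only the generators of \<open>L\<close> and of \<open>I(B)\<close> need to be checked.\<close>
  let ?M = "{f \<in> polys_in (cvars \<O>). eliminate f \<in> Idl\<^bsub>?P\<^esub> ?S} :: ('n cvar, 'k) mpoly set"
  note h = unital_hom_props[OF unital_hom_eliminate]
  have M: "?M \<subseteq> polys_in (cvars \<O>)" "is_submodule (polys_in (cvars \<O>)) ?M"
    using is_submodule_zero[OF I] is_submodule_add[OF I] is_submodule_mult[OF I eliminate_in]
      is_subring_closed[OF is_subring_polys_in[of "cvars \<O>"]]
    by (auto simp: is_submodule_def h)
  have "L_ideal \<O> \<sigma> \<subseteq> ?M" unfolding L_ideal_def
  proof (rule genideal_least[OF L_generators M], clarify)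
    fix t b assume tb: "(t, b) \<in> cvars \<O>" "(t, b) \<notin> S_vars \<O> \<sigma>"
    then have "\<not> t \<preceq> b" by (auto simp: S_vars_def le_iff cvars_def border_def)
    then show "cpoly t b \<in> polys_in (cvars \<O>) \<and> eliminate (cpoly t b) \<in> Idl\<^bsub>?P\<^esub> ?S"
      using cpoly_in_polys_in[OF tb(1)] is_submodule_zero[OF I]
      by (simp add: eliminate_cpoly lookup_reduct_not_le)
  qed
  moreover have "border_scheme_ideal \<O> \<subseteq> ?M" unfolding border_scheme_ideal_def
  proof (rule genideal_least[OF border_generators M], clarify)
    fix k l t s assume ts: "t \<in> \<O>" "s \<in> \<O>"
    then have "lookup (syzygy k l s) t \<in> ?S" by blast
    then have "lookup (syzygy k l s) t \<in> Idl\<^bsub>?P\<^esub> ?S"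
      by (rule subsetD[OF genideal_superset[OF S]])
    with ts show "commutator_entry \<O> k l t s \<in> polys_in (cvars \<O>) \<and>
        eliminate (commutator_entry \<O> k l t s) \<in> Idl\<^bsub>?P\<^esub> ?S"
      by (simp add: commutator_entry_in eliminate_commutator_entry)
  qed
  ultimately have "scheme_sum \<subseteq> ?M"
    using is_submodule_add[OF M(2)] unfolding subset_iff scheme_sum_iff by blast
  then show "?J \<subseteq> Idl\<^bsub>?P\<^esub> ?S"
    using eliminate_ident by (fastforce simp: groebner_scheme_ideal_def)
  show "Idl\<^bsub>?P\<^esub> ?S \<subseteq> ?J"
    using ideal_groebner_scheme_ideal gstar_module_coeff[OF syzygy_in syzygy_keys lookup_syzygy_in]
    by (intro genideal_least[OF S]) (auto simp: ideal_poly_ring_iff)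
qed

end

section \<open>Rational points and zero-dimensional ideals\<close>

context order_ideal_with_order
begin

abbreviation fibre :: "('n cvar \<Rightarrow> 'k::field) \<Rightarrow> ('n, 'k) mpoly set" where
  "fibre a \<equiv> Idl\<^bsub>poly_ring UNIV\<^esub> ((\<lambda>b. specialize a (gstar \<O> \<sigma> b)) ` corners \<O>)"

lemma fibre_eq: "fibre a = combinations UNIV (corners \<O>) (\<lambda>b. specialize a (gstar \<O> \<sigma> b))"
  by (rule genideal_eq_combinations[OF finite_corners])

lemma is_submodule_fibre: "is_submodule UNIV (fibre a)"
  unfolding fibre_eq by (rule is_submodule_combinations[OF is_subring_UNIV])

lemma specialize_gstar_module:
  assumes "f \<in> gstar_module"
  shows "specialize a f \<in> fibre a"
proof -
  obtain g where "f = (\<Sum>b\<in>corners \<O>. g b * gstar \<O> \<sigma> b)"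
    using assms by (auto simp: gstar_module_def combinations_def)
  then have "specialize a f = (\<Sum>b\<in>corners \<O>. specialize a (g b) * specialize a (gstar \<O> \<sigma> b))"
    by (simp add: unital_hom_props[OF unital_hom_specialize])
  then show ?thesis unfolding fibre_eq combinations_def by auto
qed

lemma keys_specialize: "keys (specialize a f) \<subseteq> keys f"
  using unital_hom_props(3)[OF unital_hom_eval_mpoly[of a]]
  by (auto simp: in_keys_iff lookup_specialize)

lemma specialize_single_diff: "specialize a (single m 1 - f) = single m 1 - specialize a f"
  by (simp add: unital_hom_props[OF unital_hom_specialize] specialize_single
      unital_hom_props[OF unital_hom_eval_mpoly])

lemma specialize_reduct: "single m 1 - specialize a (reduct m) \<in> fibre a"
  using specialize_gstar_module[OF reduct_cong, of a m] by (simp add: specialize_single_diff)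

lemma fibre_normal_form: "\<exists>f. keys f \<subseteq> \<O> \<and> p - f \<in> fibre a"
proof -
  have "keys (specialize a (reduct s)) \<subseteq> \<O>" for s
    using keys_specialize[of a "reduct s"] reduct_keys[of s] by blast
  then show ?thesis
    using replace_terms[OF is_subring_UNIV, of "fibre a" p \<O>] specialize_reduct
      is_submodule_fibre by (force simp: coeffs_in_UNIV)
qed

definition zeros :: "('n cvar \<Rightarrow> 'k::field) set" where
  "zeros = rational_zeros (S_corner_vars \<O> \<sigma>) (groebner_scheme_ideal \<O> \<sigma>)"

text \<open>
  The coefficients of the syzygies vanish at \<open>a\<close>, so the reduction matrices commute after
  specialisation. They annihilate the generators of the ideal of \<open>a\<close> and are triangular because
  reduction does not produce larger terms.
\<close>

lemma fibre_leading_term: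
  fixes a :: "'n cvar \<Rightarrow> 'k::field"
  assumes a: "a \<in> zeros" and f: "f \<in> fibre a" "f \<noteq> 0"
  shows "leading_term \<sigma> f \<notin> \<O>"
proof
  assume t: "leading_term \<sigma> f \<in> \<O>"
  note e = unital_hom_props[OF unital_hom_eval_mpoly[of a]]
  interpret cm: commuting_matrices \<sigma> \<O> "\<lambda>k t s. eval_mpoly a (reduct_mat k t s)" "{0 :: 'k}"
  proof
    fix k l t s assume "t \<in> \<O>" "s \<in> \<O>"
    have "lookup (syzygy k l s) t \<in> groebner_scheme_ideal \<O> \<sigma>"
      by (rule gstar_module_coeff[OF syzygy_in syzygy_keys lookup_syzygy_in])
    then have "eval_mpoly a (lookup (syzygy k l s) t) = 0"
      using a by (auto simp: zeros_def rational_zeros_def)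
    then show "(\<Sum>u\<in>\<O>. eval_mpoly a (reduct_mat k t u) * eval_mpoly a (reduct_mat l u s)) -
       (\<Sum>u\<in>\<O>. eval_mpoly a (reduct_mat l t u) * eval_mpoly a (reduct_mat k u s)) \<in> {0}"
      by (simp add: syzygy_def lookup_minus lookup_reduct2 e)
  qed (auto simp: is_submodule_def reduct_mat_def reduct_O lookup_single when_def e)
  have "specialize a (gstar \<O> \<sigma> b) \<in> cm.vanishing" if b: "b \<in> corners \<O>" for b
  proof -
    obtain k s where s: "s \<in> \<O>" "b = indet k + s" using b by (rule corner_border)
    have "keys (specialize a (gstar_tail b)) \<subseteq> \<O>"
      using keys_specialize[of a "gstar_tail b"] keys_gstar_tail[of b] by blast
    then show ?thesis unfolding gstar_eq specialize_single_diff
      unfolding s(2) using s b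
      by (intro cm.border_vanishing)
        (auto simp: reduct_mat_def reduct_corner lookup_specialize)
  qed
  then have "fibre a \<subseteq> cm.vanishing"
    unfolding fibre_eq by (intro combinations_least cm.is_submodule_vanishing)
  moreover have "eval_mpoly a (reduct_mat k t s) \<in> {0}" if "\<not> t \<preceq> indet k + s" for k s t
    using that by (simp add: reduct_mat_def lookup_reduct_not_le e)
  ultimately have "lookup f (leading_term \<sigma> f) \<in> {0}"
    using f t le_leading_term leading_term_in_keys by (intro cm.vanishing_leading_coeff) auto
  then show False using leading_term_in_keys[OF f(2)] by (simp add: in_keys_iff)
qed

lemma nonleading_fibre:
  assumes "a \<in> zeros"
  shows "nonleading_terms \<sigma> (fibre a) = \<O>"
proof
  show "\<O> \<subseteq> nonleading_terms \<sigma> (fibre a)"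
    using fibre_leading_term[OF assms] by (auto simp: nonleading_terms_def)
  show "nonleading_terms \<sigma> (fibre a) \<subseteq> \<O>"
  proof (rule subsetI, rule ccontr)
    fix m assume m: "m \<in> nonleading_terms \<sigma> (fibre a)" "m \<notin> \<O>"
    have "s \<prec> m" if "s \<in> keys (specialize a (reduct m))" for s
      using that keys_specialize[of a "reduct m"] reduct_keys[of m] m(2) by (auto simp: le_iff)
    then show False
      using leading_term_single_diff[of "specialize a (reduct m)" m] specialize_reduct[of m a] m(1)
      by (auto simp: nonleading_terms_def)
  qed
qed

text \<open>
  The specialisations of \<open>g\<^sub>b\<^sup>*\<close> at two points with the same ideal differ by an element of this ideal
  supported on \<open>\<O>\<close>, which is zero.
\<close>

lemma fibre_inj: "inj_on fibre (zeros :: ('n cvar \<Rightarrow> 'k::field) set)"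
proof (rule inj_onI)
  fix a a' :: "'n cvar \<Rightarrow> 'k" assume a: "a \<in> zeros" "a' \<in> zeros" "fibre a = fibre a'"
  have "a (t, b) = a' (t, b)" if tb: "(t, b) \<in> S_corner_vars \<O> \<sigma>" for t b
  proof -
    have b: "b \<in> corners \<O>" and t: "t \<in> \<O>" "t \<prec> b" using tb by (simp_all add: S_corner_vars_iff)
    let ?g = "specialize a' (gstar_tail b) - specialize a (gstar_tail b)"
    have g: "single b 1 - specialize c (gstar_tail b) \<in> fibre c" for c :: "'n cvar \<Rightarrow> 'k"
      using specialize_reduct[of b c] by (simp add: reduct_corner[OF b])
    have "(single b 1 - specialize a (gstar_tail b)) - (single b 1 - specialize a' (gstar_tail b)) \<in> fibre a"
      by (rule is_submodule_diff[OF is_submodule_fibre is_subring_UNIV g[of a] g[of a', folded a(3)]])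
    then have "?g \<in> fibre a" by simp
    moreover have "keys ?g \<subseteq> \<O>"
      by (rule subsetI, rule ccontr)
        (simp add: in_keys_iff lookup_minus lookup_specialize lookup_gstar_tail
          unital_hom_props[OF unital_hom_eval_mpoly])
    ultimately have "?g = 0" using nonleading_O_zero[OF nonleading_fibre[OF a(1)]] by blast
    then have "lookup ?g t = 0" by simp
    then show ?thesis using t
      by (simp add: lookup_minus lookup_specialize lookup_gstar_tail eval_mpoly_cpoly)
  qed
  then have "a x = a' x" if "x \<in> S_corner_vars \<O> \<sigma>" for x using that by (cases x) simp
  moreover have "a \<in> S_corner_vars \<O> \<sigma> \<rightarrow>\<^sub>E UNIV" "a' \<in> S_corner_vars \<O> \<sigma> \<rightarrow>\<^sub>E UNIV"
    using a(1,2) by (simp_all add: zeros_def rational_zeros_def)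
  ultimately show "a = a'" by (intro PiE_ext)
qed

text \<open>
  The point is read off the normal forms of the corners modulo \<open>I\<close>. It is a zero of \<open>J\<close> since the
  specialised syzygies lie in \<open>I\<close> and are supported on \<open>\<O>\<close>. The ideal of the point cannot be smaller than
  \<open>I\<close>, because \<open>\<O>\<close> spans the quotient by it and no nonzero combination of \<open>\<O>\<close> lies in \<open>I\<close>.
\<close>

lemma fibre_surj:
  fixes I :: "('n, 'k::field) mpoly set"
  assumes I: "is_submodule UNIV I" "nonleading_terms \<sigma> I = \<O>"
  shows "\<exists>a\<in>zeros. fibre a = I"
proof -
  have step: "\<exists>f\<in>coeffs_in UNIV. (\<forall>s\<in>keys f. s \<prec> m) \<and> single m 1 - f \<in> I" if m: "m \<notin> \<O>" for m
  proof -
    obtain f where f: "f \<in> I" "f \<noteq> 0" "leading_term \<sigma> f = m"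
      using I(2) m by (auto simp: nonleading_terms_def)
    let ?c = "inverse (lookup f m)"
    let ?g = "single m 1 - single 0 ?c * f"
    have c: "lookup f m \<noteq> 0" using leading_term_in_keys[OF f(2)] f(3) by (simp add: in_keys_iff)
    \<comment> \<open>Normalising the leading coefficient of \<open>f\<close> cancels \<open>m\<close> and leaves smaller terms.\<close>
    have "s \<prec> m" if s: "s \<in> keys ?g" for s
    proof -
      have "s \<noteq> m" using s c by (auto simp: in_keys_iff lookup_minus lookup_const_mult)
      moreover from this s have "s \<in> keys f"
        by (auto simp: in_keys_iff lookup_minus lookup_const_mult lookup_single when_def)
      ultimately show ?thesis using le_leading_term[OF f(2)] f(3) by (auto simp: le_iff)
    qed
    moreover have "single m 1 - ?g \<in> I" using is_submodule_mult[OF I(1) _ f(1)] by simp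
    ultimately show ?thesis unfolding coeffs_in_UNIV by blast
  qed
  have "is_submodule (coeffs_in UNIV) I" using I(1) by (simp add: coeffs_in_UNIV)
  then have "\<forall>m. \<exists>f. keys f \<subseteq> {t\<in>\<O>. t \<preceq> m} \<and> single m 1 - f \<in> I"
    using normal_form_term[OF is_subring_UNIV _ step] by blast
  from choice[OF this] obtain W where
    W: "\<And>m. keys (W m) \<subseteq> {t\<in>\<O>. t \<preceq> m}" "\<And>m. single m 1 - W m \<in> I"
    by blast
  define a where "a = restrict (\<lambda>(t, b). lookup (W b) t) (S_corner_vars \<O> \<sigma>)"
  have "specialize a (gstar \<O> \<sigma> b) = single b 1 - W b" if b: "b \<in> corners \<O>" for b
  proof -
    have "specialize a (gstar_tail b) = W b"
    proof (rule poly_mapping_eqI)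
      fix t
      show "lookup (specialize a (gstar_tail b)) t = lookup (W b) t"
      proof (cases "t \<in> \<O> \<and> t \<prec> b")
        case True
        then show ?thesis using b
          by (simp add: lookup_specialize lookup_gstar_tail eval_mpoly_cpoly a_def S_corner_vars_iff)
      next
        case False
        then have "t \<notin> keys (W b)" using W(1)[of b] corner_not_in_O[OF b] by (auto simp: le_iff)
        with False show ?thesis
          by (auto simp: lookup_specialize lookup_gstar_tail in_keys_iff
              unital_hom_props[OF unital_hom_eval_mpoly])
      qed
    qed
    then show ?thesis by (simp add: gstar_eq specialize_single_diff)
  qed
  then have sub: "fibre a \<subseteq> I"
    unfolding fibre_eq using W(2) by (intro combinations_least I(1)) simp
  have "eval_mpoly a (lookup (syzygy k l s) t) = 0" for k l s t
  proof -
    have "specialize a (syzygy k l s) \<in> I"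
      using sub specialize_gstar_module[OF syzygy_in] by blast
    then have "specialize a (syzygy k l s) = 0"
      using nonleading_O_zero[OF I(2)] keys_specialize[of a "syzygy k l s"] syzygy_keys[of k l s] by blast
    then show ?thesis by (metis lookup_specialize lookup_zero)
  qed
  moreover have "is_submodule coeff_ring {f \<in> coeff_ring. eval_mpoly a f = 0}"
    using is_subring_closed[OF is_subring_polys_in[of "S_corner_vars \<O> \<sigma>"]]
    by (auto simp: is_submodule_def unital_hom_props[OF unital_hom_eval_mpoly])
  ultimately have "groebner_scheme_ideal \<O> \<sigma> \<subseteq> {f \<in> coeff_ring. eval_mpoly a f = 0}"
    unfolding groebner_scheme_ideal_eq using lookup_syzygy_in
    by (intro genideal_least) auto
  then have a: "a \<in> zeros"
    by (auto simp: zeros_def rational_zeros_def a_def)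
  have "I \<subseteq> fibre a"
  proof
    fix p assume p: "p \<in> I"
    obtain f where f: "keys f \<subseteq> \<O>" "p - f \<in> fibre a" using fibre_normal_form by blast
    then have "p - f \<in> I" using sub by blast
    from is_submodule_diff[OF I(1) is_subring_UNIV p this] have "f \<in> I" by simp
    then have "f = 0" using nonleading_O_zero[OF I(2)] f(1) by simp
    then show "p \<in> fibre a" using f(2) by simp
  qed
  with sub a show ?thesis by blast
qed

lemma parametrizing_groebner_scheme_ideal:
  "parametrizing_ideal \<O> \<sigma> (groebner_scheme_ideal \<O> \<sigma> :: ('n cvar, 'k::field) mpoly set)"
proof -
  let ?Is = "{I :: ('n, 'k) mpoly set. ideal I (poly_ring UNIV) \<and> zero_dimensional I \<and> nonleading_terms \<sigma> I = \<O>}"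
  have "fibre a \<in> ?Is" if "a \<in> zeros" for a :: "'n cvar \<Rightarrow> 'k"
    using nonleading_fibre[OF that] is_submodule_fibre[of a] zero_dimensionalI[OF fibre_normal_form]
    by (simp add: ideal_poly_ring_iff polys_in_UNIV)
  moreover have "\<exists>a\<in>zeros. fibre a = I" if "I \<in> ?Is" for I
    using that by (intro fibre_surj) (auto simp: ideal_poly_ring_iff polys_in_UNIV)
  ultimately have "fibre ` zeros = ?Is" by blast
  then have "bij_betw fibre zeros ?Is" using fibre_inj by (simp add: bij_betw_def)
  then show ?thesis
    using ideal_groebner_scheme_ideal by (simp add: parametrizing_ideal_def zeros_def)
qed

text \<open>
  The reduction polynomials are the syzygies, and \<open>lookup\<close> lists their coefficients.
\<close>

lemma reduction_groebner_scheme_ideal: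
  "reduction_ideal \<O> \<sigma> (groebner_scheme_ideal \<O> \<sigma> :: ('n cvar, 'k::field) mpoly set)"
proof -
  let ?S = "(\<lambda>(k, l, s). syzygy k l s) ` (UNIV \<times> UNIV \<times> \<O>) :: ('n, ('n cvar, 'k) mpoly) mpoly set"
  have "finite ?S" using finite_O by simp
  moreover have "\<exists>f. (\<forall>b\<in>corners \<O>. f b \<in> coeffs_in coeff_ring) \<and>
      syzygy k l s = (\<Sum>b\<in>corners \<O>. f b * gstar \<O> \<sigma> b)" for k l s
    using syzygy_in[of k l s] unfolding gstar_module_def combinations_def by blast
  moreover have "syzygy k l s = (\<Sum>t\<in>\<O>. single t (lookup (syzygy k l s) t))" for k l s
    by (rule poly_expand_superset[OF finite_O syzygy_keys])
  moreover have "{lookup (syzygy k l s) t | k l s t. s \<in> \<O> \<and> t \<in> \<O>} = {lookup h t | h t. h \<in> ?S \<and> t \<in> \<O>}"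
    by force
  ultimately show ?thesis
    unfolding reduction_ideal_def
    using parametrizing_groebner_scheme_ideal groebner_scheme_ideal_eq lookup_syzygy_in
    by (intro conjI exI[of _ ?S] exI[of _ lookup]) auto
qed

end

theorem proposition3p5:
  fixes \<O> :: "'n::finite monom set" and \<sigma> :: "'n monom rel"
  assumes "order_ideal \<O>" and "\<O> \<noteq> {}" and "term_ordering \<sigma>"
  shows "reduction_ideal \<O> \<sigma> (groebner_scheme_ideal \<O> \<sigma> :: ('n cvar, 'k::field) mpoly set)"
proof -
  interpret order_ideal_with_order \<sigma> \<O>
    using assms by unfold_locales
  show ?thesis by (rule reduction_groebner_scheme_ideal)
qed

end
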